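(* Let $(\gamma_k)_{k\ge 0}$ be a sequence of positive integers with $$\prod_{\ell\ge 0}\Big(1-\frac{1}{4\gamma_\ell}\Big)>0,$$ and put $\Gamma_k=\gamma_k$ for all $k\ge 0$. Let $T$ be a rank-one transformation constructed from the parameters $(\Gamma_k)_{k\ge0}$, $(\gamma_k)_{k\ge0}$ by the construction described in the context. Then $T\times T$ is ergodic, but $T\times T^{-1}$ is not ergodic (with respect to the product measure).
   Context: Rank-one transformations. A column is a finite ordered collection of pairwise disjoint intervals (levels) of equal length; its height is the number of levels, levels are numbered (their height) from $0$ (base) upward, and its column map sends each level to the next one up by translation. A rank-one (cutting-and-stacking) transformation $T$ is given by columns $C_0,C_1,\dots$ where $C_0$ is the single level $[0,1]$ and $C_{n+1}$ is obtained from $C_n$ by cutting $C_n$ into $r_n\ge 2$ subcolumns of equal width, placing $s_{n,k}\ge 0$ new levels (spacers) above the $k$-th subcolumn ($0\le k\le r_n-1$), and stacking every subcolumn under the one to its right. $X=\bigcup_n C_n$ carries Lebesgue measure $\mu$, and $T$ is the pointwise limit of the column maps (an invertible measure-preserving transformation, mod null sets). Let $h_n$ be the height of $C_n$ and $h_{n,k}=h_n+s_{n,k}$. The height set of $T$ at stage $j$ is $H_j=\{0\}\cup\{\sum_{k=0}^{i}h_{j,k} : 0\le i<r_j-1\}$. Specifying the spacers below the last subcolumn at each stage is the same as specifying finite sets $H_j\subset\mathbb{Z}_{\ge 0}$ with $0\in H_j$, at least two elements, and any two distinct elements at distance at least $h_j$. The construction. Given positive integers $\Gamma_k,\gamma_k$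 ($k\ge0$), the height sets are chosen inductively: given $H_0,\dots,H_{k-1}$ (hence $C_k$), choose an integer $M_k$ with $M_k>2\max(H_0\oplus\cdots\oplus H_{k-1})+1$ (the maximum is $0$ if $k=0$) and $M_k\ge h_k$, and let $H_k$ be a set of $2\Gamma_k+2\gamma_k$ distinct nonnegative integers, containing $0$, of the form $H_k=\{V_1,W_1,\dots,V_{\Gamma_k},W_{\Gamma_k},v_1,w_1,\dots,v_{\gamma_k},w_{\gamma_k}\}$ such that, with $H_k(U)=\{\{V_r,W_r\}:1\le r\le\Gamma_k\}$ and $H_k(L)=\{\{v_s,w_s\}:1\le s\le\gamma_k\}$: (1) for every $\{V,W\}\in H_k(U)$ and $\{v,w\}\in H_k(L)$ one has $V+W=v+w-1$; (2) if $x_1,x_2,x_3,x_4\in H_k$ and $|x_1+x_2-x_3-x_4|<M_k$, then precisely one of the following holds: (i) $\{x_1,x_2\}=\{x_3,x_4\}$; (ii) $\{x_1,x_2\}\ne\{x_3,x_4\}$, $x_1+x_2=x_3+x_4$, and $\{x_1,x_2\},\{x_3,x_4\}$ are both in $H_k(U)$ or both in $H_k(L)$; (iii) $x_1+x_2=x_3+x_4-1$, $\{x_1,x_2\}\in H_k(U)$ and $\{x_3,x_4\}\in H_k(L)$; (iv) $x_1+x_2=x_3+x_4+1$, $\{x_1,x_2\}\in H_k(L)$ and $\{x_3,x_4\}\in H_k(U)$. Here $A\oplus B=\{a+b:a\in A,b\in B\}$. A measure-preserving transformation $S$ is ergodic if $S^{-1}(A)=A$ implies that $A$ or $A^c$ is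 null. *)

theory Defs
  imports "HOL-Analysis.Analysis"
begin

section \<open>Columns\<close>

text \<open>A column is given by the common width of its levels and the list of their left endpoints,
  from the base upward. Levels are half-open, so that cutting a level really partitions it;
  in particular the initial column is \<open>[0,1)\<close> rather than \<open>[0,1]\<close>.\<close>

record column =
  col_width :: real
  col_lefts :: "real list"

definition col_height :: "column \<Rightarrow> nat" where
  "col_height C = length (col_lefts C)"

definition level :: "column \<Rightarrow> nat \<Rightarrow> real set" where
  "level C i = {col_lefts C ! i ..< col_lefts C ! i + col_width C}"

definition is_column :: "column \<Rightarrow> bool" where
  "is_column C \<longleftrightarrow> 0 < col_width C \<and> 0 < col_height C \<and>
     disjoint_family_on (level C) {..<col_height C}"

definition col_union :: "column \<Rightarrow> real set" where
  "col_union C = (\<Union>i<col_height C. level C i)"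

text \<open>The column map is extended by the identity to the points where it is undefined
  (the top level and the complement of the column).\<close>

definition column_map :: "column \<Rightarrow> real \<Rightarrow> real" where
  "column_map C x =
     (if \<exists>i. Suc i < col_height C \<and> x \<in> level C i
      then let i = (THE i. Suc i < col_height C \<and> x \<in> level C i)
           in x - col_lefts C ! i + col_lefts C ! Suc i
      else x)"

text \<open>Cut into \<open>r\<close> subcolumns of equal width, put new levels with left endpoints \<open>S k\<close> above the
  \<open>k\<close>-th subcolumn, and stack from left (bottom) to right (top). Only \<open>S k\<close> for \<open>k < r\<close> matters.\<close>

definition cut_and_stack :: "nat \<Rightarrow> (nat \<Rightarrow> real list) \<Rightarrow> column \<Rightarrow> column" where
  "cut_and_stack r S C =
     \<lparr> col_width = col_width C / real r,
       col_lefts = concat (map (\<lambda>k. map (\<lambda>a. a + real k * (col_width C / real r)) (col_lefts C) @ S k)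
                              [0..<r]) \<rparr>"

section \<open>Rank-one transformations\<close>

text \<open>\<open>r n\<close> is the number of cuts at stage \<open>n\<close> and \<open>S n k\<close> lists the spacers above the \<open>k\<close>-th
  subcolumn of the \<open>n\<close>-th column. The position of the spacers on the line is arbitrary; they are
  new because the next column is again required to have pairwise disjoint levels.\<close>

primrec columns :: "(nat \<Rightarrow> nat) \<Rightarrow> (nat \<Rightarrow> nat \<Rightarrow> real list) \<Rightarrow> nat \<Rightarrow> column" where
  "columns r S 0 = \<lparr> col_width = 1, col_lefts = [0] \<rparr>"
| "columns r S (Suc n) = cut_and_stack (r n) (S n) (columns r S n)"

definition rank_one :: "(nat \<Rightarrow> nat) \<Rightarrow> (nat \<Rightarrow> nat \<Rightarrow> real list) \<Rightarrow> bool" where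
  "rank_one r S \<longleftrightarrow> (\<forall>n. r n \<ge> 2) \<and> (\<forall>n. is_column (columns r S n))"

definition rank_one_space :: "(nat \<Rightarrow> nat) \<Rightarrow> (nat \<Rightarrow> nat \<Rightarrow> real list) \<Rightarrow> real set" where
  "rank_one_space r S = (\<Union>n. col_union (columns r S n))"

definition rank_one_measure :: "(nat \<Rightarrow> nat) \<Rightarrow> (nat \<Rightarrow> nat \<Rightarrow> real list) \<Rightarrow> real measure" where
  "rank_one_measure r S = restrict_space lborel (rank_one_space r S)"

definition rank_one_map :: "(nat \<Rightarrow> nat) \<Rightarrow> (nat \<Rightarrow> nat \<Rightarrow> real list) \<Rightarrow> real \<Rightarrow> real" where
  "rank_one_map r S x = lim (\<lambda>n. column_map (columns r S n) x)"

text \<open>On the space, the map is injective and misses only the point \<open>0\<close> (the intersection of the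
  bases of all columns); on this null set the inverse is the identity by convention.\<close>

definition rank_one_inv :: "(nat \<Rightarrow> nat) \<Rightarrow> (nat \<Rightarrow> nat \<Rightarrow> real list) \<Rightarrow> real \<Rightarrow> real" where
  "rank_one_inv r S x =
     (if x \<in> rank_one_map r S ` rank_one_space r S
      then inv_into (rank_one_space r S) (rank_one_map r S) x else x)"

definition subcolumn_height :: "(nat \<Rightarrow> nat) \<Rightarrow> (nat \<Rightarrow> nat \<Rightarrow> real list) \<Rightarrow> nat \<Rightarrow> nat \<Rightarrow> nat" where
  "subcolumn_height r S n k = col_height (columns r S n) + length (S n k)"

definition height_set :: "(nat \<Rightarrow> nat) \<Rightarrow> (nat \<Rightarrow> nat \<Rightarrow> real list) \<Rightarrow> nat \<Rightarrow> int set" where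
  "height_set r S j =
     {0} \<union> {\<Sum>k=0..i. int (subcolumn_height r S j k) | i. i < r j - 1}"

section \<open>The construction of the height sets\<close>

definition pair_set :: "nat \<Rightarrow> (nat \<Rightarrow> int) \<Rightarrow> (nat \<Rightarrow> int) \<Rightarrow> int set set" where
  "pair_set n V W = {{V i, W i} | i. 1 \<le> i \<and> i \<le> n}"

definition exactly_one :: "bool list \<Rightarrow> bool" where
  "exactly_one ps \<longleftrightarrow> (\<exists>!i. i < length ps \<and> ps ! i)"

definition stage_condition :: "int \<Rightarrow> int set \<Rightarrow> int set set \<Rightarrow> int set set \<Rightarrow> bool" where
  "stage_condition M H HU HL \<longleftrightarrow>
     (\<forall>V W v w. {V, W} \<in> HU \<and> {v, w} \<in> HL \<longrightarrow> V + W = v + w - 1) \<and>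
     (\<forall>x1\<in>H. \<forall>x2\<in>H. \<forall>x3\<in>H. \<forall>x4\<in>H. \<bar>x1 + x2 - x3 - x4\<bar> < M \<longrightarrow>
        exactly_one
          [{x1, x2} = {x3, x4},
           {x1, x2} \<noteq> {x3, x4} \<and> x1 + x2 = x3 + x4 \<and>
             ({x1, x2} \<in> HU \<and> {x3, x4} \<in> HU \<or> {x1, x2} \<in> HL \<and> {x3, x4} \<in> HL),
           x1 + x2 = x3 + x4 - 1 \<and> {x1, x2} \<in> HU \<and> {x3, x4} \<in> HL,
           x1 + x2 = x3 + x4 + 1 \<and> {x1, x2} \<in> HL \<and> {x3, x4} \<in> HU])"

text \<open>The sum of sets below is the Minkowski sum; for \<open>k = 0\<close> it is \<open>{0}\<close>, with maximum \<open>0\<close>.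
  The cardinality requirement says that all the \<open>V\<close>, \<open>W\<close>, \<open>v\<close>, \<open>w\<close> are distinct.\<close>

definition constructed_from ::
  "(nat \<Rightarrow> nat) \<Rightarrow> (nat \<Rightarrow> nat) \<Rightarrow> (nat \<Rightarrow> nat) \<Rightarrow> (nat \<Rightarrow> nat \<Rightarrow> real list) \<Rightarrow> bool" where
  "constructed_from \<Gamma> \<gamma> r S \<longleftrightarrow>
     (\<forall>k. \<exists>M V W v w.
        M > 2 * Max (\<Sum>i<k. height_set r S i) + 1 \<and>
        M \<ge> int (col_height (columns r S k)) \<and>
        height_set r S k = V ` {1..\<Gamma> k} \<union> W ` {1..\<Gamma> k} \<union> v ` {1..\<gamma> k} \<union> w ` {1..\<gamma> k} \<and>
        card (height_set r S k) = 2 * \<Gamma> k + 2 * \<gamma> k \<and>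
        stage_condition M (height_set r S k) (pair_set (\<Gamma> k) V W) (pair_set (\<gamma> k) v w))"

section \<open>Ergodicity\<close>

definition ergodic :: "'a measure \<Rightarrow> ('a \<Rightarrow> 'a) \<Rightarrow> bool" where
  "ergodic M S \<longleftrightarrow>
     (\<forall>A\<in>sets M. S -` A \<inter> space M = A \<longrightarrow> A \<in> null_sets M \<or> space M - A \<in> null_sets M)"

end

theory Submission
  imports Defs
begin

text \<open>
  A point of the unit interval is a sequence of digits: its height in column \<open>n\<close> is a sum of one
  element from each of the first \<open>n\<close> height sets, and under Lebesgue measure these digits are
  independent and uniformly distributed. Applying \<open>T\<close> raises the height of a point by one in all
  late columns. Hence \<open>T \<times> T\<close> preserves the difference of the heights of two points and
  \<open>T \<times> T\<inverse>\<close> preserves their sum, and both claims are about the additive relations between digits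
  that the construction allows. Each height set splits into two halves \<open>U\<close> and \<open>L\<close> of \<open>2 * \<gamma>\<close>
  elements; partners in \<open>U\<close> add up to a constant \<open>\<sigma>\<close>, partners in \<open>L\<close> to \<open>\<sigma> + 1\<close>.

  Ergodicity of \<open>T \<times> T\<close>. Let \<open>A\<close> be invariant. Replacing a pair of digits \<open>(a, b)\<close> in \<open>U \<times> L\<close> by
  the pair \<open>(\<sigma> + 1 - b, \<sigma> - a)\<close> in \<open>L \<times> U\<close> raises the difference by exactly one. So in
  every rectangle of levels, the piece with digits \<open>(a, b)\<close> is moved by a power of \<open>T \<times> T\<close> to where
  \<open>1 \<times> T\<close> moves the piece with the exchanged digits. These exchanges involve two quarters of the
  rectangle, and they prevent the set of points of \<open>A\<close> that leave \<open>A\<close> under \<open>1 \<times> T\<close> from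
  filling more than three quarters of any rectangle (\<open>measure_leaving_le\<close>). A set with such a
  density bound is null (\<open>null_if_density_bounded\<close>). With the same argument for the complement, \<open>A\<close>
  is invariant under \<open>1 \<times> T\<close> up to a null set. Therefore \<open>A\<close> has the same density in all
  rectangles of all stages (\<open>measure_inter_rect_eq\<close>), and a density below one forces \<open>A\<close> to be null.

  Failure of ergodicity for \<open>T \<times> T\<inverse>\<close>. If \<open>a\<close> and \<open>b\<close> are not partners, then the sum of the
  heights determines the unordered pair of these digits, whatever the lower digits are. Hence the
  pairs of points of the unit interval that have partnered digits at no stage are recognised by the
  sum of their heights alone (\<open>unpartnered_determined_by_sum\<close>), and the pairs of points with
  such sums in all late columns form an invariant set. Digits of stage \<open>n\<close> are partners with probability
  \<open>1 / (4 * \<gamma> n)\<close>, so this set has positive measure as soon as the infinite product is positive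
  (\<open>rigid_set_not_null\<close>). Its complement contains the pairs of points whose first digits are
  partners (\<open>rigid_set_compl_not_null\<close>).
\<close>

section \<open>Concatenated blocks and subdivided intervals\<close>

lemma nth_concat_map_upt:
  assumes "k < r" "i < length (f k)"
  shows "concat (map f [0..<r]) ! ((\<Sum>k'<k. length (f k')) + i) = f k ! i"
    and "(\<Sum>k'<k. length (f k')) + i < length (concat (map f [0..<r]))"
proof -
  have len: "length (concat (map f [0..<m])) = (\<Sum>k'<m. length (f k'))" for m
    by (induction m) auto
  have "concat (map f [0..<r]) = concat (map f [0..<k]) @ concat (map f [k..<r])"
    using assms(1) by (metis concat_append le_add_diff_inverse less_imp_le_nat map_append upt_add_eq_append zero_le)
  also have "[k..<r] = k # [Suc k..<r]"
    using assms(1) by (simp add: upt_conv_Cons)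
  finally have eq: "concat (map f [0..<r]) = concat (map f [0..<k]) @ f k @ concat (map f [Suc k..<r])"
    by simp
  show "concat (map f [0..<r]) ! ((\<Sum>k'<k. length (f k')) + i) = f k ! i"
    unfolding eq using assms(2) by (simp add: nth_append len)
  show "(\<Sum>k'<k. length (f k')) + i < length (concat (map f [0..<r]))"
    unfolding eq using assms(2) by (simp add: len)
qed

lemma half_open_interval_subdivision:
  fixes l u :: real
  assumes "0 < u" "m > 0"
  shows "{l..<l + u * real m} = (\<Union>k<m. {l + real k * u..<l + real k * u + u})"
proof (intro set_eqI iffI)
  fix x assume x: "x \<in> {l..<l + u * real m}"
  define k where "k = nat \<lfloor>(x - l) / u\<rfloor>"
  have k: "real k \<le> (x - l) / u" "(x - l) / u < real k + 1"
    using x assms unfolding k_def by (simp_all add: of_nat_floor)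
  then have "real k * u \<le> x - l" "x - l < real k * u + u"
    using assms by (simp_all add: field_simps)
  moreover have "(x - l) / u < real m" using x assms by (simp add: field_simps)
  with k(1) have "k < m" by linarith
  ultimately show "x \<in> (\<Union>k<m. {l + real k * u..<l + real k * u + u})" by force
next
  fix x assume "x \<in> (\<Union>k<m. {l + real k * u..<l + real k * u + u})"
  then obtain k where "k < m" and k: "l + real k * u \<le> x" "x < l + real k * u + u" by auto
  then have "(real k + 1) * u \<le> real m * u" using assms by (intro mult_right_mono) auto
  with k assms show "x \<in> {l..<l + u * real m}"
    by (auto simp: algebra_simps intro: order_trans[of l "l + u * real k"])
qed

section \<open>Columns and their levels\<close>

locale rank_one_system =
  fixes r :: "nat \<Rightarrow> nat" and S :: "nat \<Rightarrow> nat \<Rightarrow> real list"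
  assumes rank_one: "rank_one r S"
begin

text \<open>Besides the height, the width, the left endpoints and the levels of the \<open>n\<close>-th column, the
  construction is described by the heights \<open>base n k\<close> at which the \<open>k\<close>-th copy of column \<open>n\<close> starts
  inside column \<open>n + 1\<close>. These heights are the elements of the height set of stage \<open>n\<close>; they are
  called digits, because the height of a point of the unit interval in column \<open>n\<close> is a sum of one
  digit from each earlier stage.\<close>
definition h :: "nat \<Rightarrow> nat" where "h n = col_height (columns r S n)"
definition w :: "nat \<Rightarrow> real" where "w n = col_width (columns r S n)"
definition lft :: "nat \<Rightarrow> nat \<Rightarrow> real" where "lft n i = col_lefts (columns r S n) ! i"
definition lev :: "nat \<Rightarrow> nat \<Rightarrow> real set" where "lev n i = level (columns r S n) i"
definition base :: "nat \<Rightarrow> nat \<Rightarrow> nat" where "base n k = (\<Sum>k'<k. subcolumn_height r S n k')"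
definition digits :: "nat \<Rightarrow> nat set" where "digits n = base n ` {..<r n}"
definition T :: "real \<Rightarrow> real" where "T = rank_one_map r S"
definition X :: "real set" where "X = rank_one_space r S"

lemma r_ge_2: "r n \<ge> 2" using rank_one by (auto simp: rank_one_def)
lemma r_pos: "0 < r n" using r_ge_2[of n] by linarith

lemma w_pos: "0 < w n" and h_pos: "0 < h n"
  using rank_one by (auto simp: rank_one_def is_column_def w_def h_def)

lemma lev_eq: "lev n i = {lft n i..<lft n i + w n}"
  by (simp add: lev_def level_def lft_def w_def)

lemma lev_unique: "x \<in> lev n i \<Longrightarrow> x \<in> lev n j \<Longrightarrow> i < h n \<Longrightarrow> j < h n \<Longrightarrow> i = j"
  using rank_one
  by (fastforce simp: rank_one_def is_column_def disjoint_family_on_def h_def lev_def)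

lemma w_Suc: "w (Suc n) = w n / real (r n)"
  by (simp add: w_def cut_and_stack_def)

lemma w_0: "w 0 = 1" and h_0: "h 0 = 1" and lft_0_0: "lft 0 0 = 0"
  by (simp_all add: w_def h_def lft_def col_height_def)

lemma w_le: "w n \<le> (1 / 2) ^ n"
proof (induction n)
  case (Suc n)
  have "w (Suc n) \<le> w n / 2"
    unfolding w_Suc using w_pos[of n] r_ge_2[of n] by (intro divide_left_mono) auto
  with Suc show ?case by simp
qed (simp add: w_0)

lemma w_tendsto_0: "w \<longlonglongrightarrow> 0"
proof (rule tendsto_sandwich[where f="\<lambda>_. 0" and h="\<lambda>n. (1/2)^n"])
  show "(\<lambda>n. (1 / 2) ^ n) \<longlonglongrightarrow> (0::real)" by (rule LIMSEQ_power_zero) simp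
qed (use w_pos w_le in \<open>auto intro!: always_eventually less_imp_le\<close>)

lemma base_0: "base n 0 = 0" by (simp add: base_def)

lemma base_gap: "k < k' \<Longrightarrow> base n k + h n \<le> base n k'"
proof -
  assume "k < k'"
  then have "base n (Suc k) \<le> base n k'"
    unfolding base_def by (intro sum_mono2) auto
  then show ?thesis by (simp add: base_def subcolumn_height_def h_def)
qed

lemma inj_base: "inj (base n)"
proof (rule linorder_injI)
  fix k k' :: nat assume "k < k'"
  then show "base n k \<noteq> base n k'" using base_gap[of k k' n] h_pos[of n] by linarith
qed

text \<open>All that is needed about the list that encodes column \<open>n + 1\<close>: level \<open>base n k + i\<close> is the
  \<open>k\<close>-th piece of level \<open>i\<close>. The spacers never have to be located.\<close>
lemma
  assumes "k < r n" "i < h n"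
  shows base_add_less: "base n k + i < h (Suc n)"
    and lft_base_add: "lft (Suc n) (base n k + i) = lft n i + real k * w (Suc n)"
proof -
  define f where "f = (\<lambda>k. map (\<lambda>a. a + real k * (w n / real (r n)))
                         (col_lefts (columns r S n)) @ S n k)"
  have len: "length (f k') = subcolumn_height r S n k'" for k'
    by (simp add: f_def subcolumn_height_def col_height_def)
  have i: "i < length (f k)"
    using assms(2) by (simp add: f_def h_def col_height_def)
  have cols: "col_lefts (columns r S (Suc n)) = concat (map f [0..<r n])"
    by (simp add: cut_and_stack_def f_def w_def)
  show "base n k + i < h (Suc n)"
    using nth_concat_map_upt(2)[of k "r n" i f, OF assms(1) i]
    by (simp add: h_def col_height_def[of "columns r S (Suc n)"] cols len base_def del: columns.simps)
  show "lft (Suc n) (base n k + i) = lft n i + real k * w (Suc n)"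
    using nth_concat_map_upt(1)[of k "r n" i f, OF assms(1) i] assms(2)
    by (simp add: lft_def cols len base_def w_Suc del: columns.simps)
       (simp add: f_def nth_append h_def col_height_def)
qed

lemma finite_digits: "finite (digits n)" by (simp add: digits_def)
lemma card_digits: "card (digits n) = r n"
  by (simp add: digits_def card_image inj_on_subset[OF inj_base])

lemma digits_gap: "a \<in> digits n \<Longrightarrow> b \<in> digits n \<Longrightarrow> a < b \<Longrightarrow> a + h n \<le> b"
proof -
  assume "a \<in> digits n" "b \<in> digits n" "a < b"
  then obtain k k' where k: "a = base n k" "b = base n k'" by (auto simp: digits_def)
  have "\<not> k' < k" "k \<noteq> k'" using base_gap[of k' k n] k \<open>a < b\<close> by auto
  then show ?thesis using base_gap[of k k' n] k by simp
qed

text \<open>Distinct digits are at least the height of the column apart, so adding a digit to a height is a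
  positional notation without carries.\<close>
lemma digit_add_unique:
  assumes "a \<in> digits n" "b \<in> digits n" "i < h n" "j < h n" "a + i = b + j"
  shows "a = b \<and> i = j"
  using digits_gap[of a n b] digits_gap[of b n a] assms by (cases a b rule: linorder_cases) auto

lemma digit_add_less: "a \<in> digits n \<Longrightarrow> i < h n \<Longrightarrow> a + i < h (Suc n)"
  using base_add_less by (auto simp: digits_def)

text \<open>Translations between levels of one column are inherited by their pieces, which is why points may
  be compared at any late stage.\<close>
lemma lft_digit_add_diff:
  "a \<in> digits n \<Longrightarrow> i < h n \<Longrightarrow> j < h n \<Longrightarrow>
    lft (Suc n) (a + i) - lft (Suc n) (a + j) = lft n i - lft n j"
  using lft_base_add by (auto simp: digits_def)

lemma lev_split:
  assumes "i < h n"
  shows "lev n i = (\<Union>a\<in>digits n. lev (Suc n) (a + i))"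
proof -
  have "lev n i = {lft n i..<lft n i + w (Suc n) * real (r n)}"
    using r_pos[of n] by (simp add: lev_eq w_Suc)
  also have "\<dots> = (\<Union>k<r n. {lft n i + real k * w (Suc n)..<lft n i + real k * w (Suc n) + w (Suc n)})"
    using w_pos r_pos by (rule half_open_interval_subdivision)
  also have "\<dots> = (\<Union>k<r n. lev (Suc n) (base n k + i))"
    using assms by (simp add: lev_eq lft_base_add)
  finally show ?thesis by (simp add: digits_def)
qed

lemma lft_bottom: "lft n 0 = 0"
proof (induction n)
  case (Suc n)
  then show ?case using lft_base_add[of 0 n 0] r_pos h_pos by (simp add: base_0)
qed (simp add: lft_0_0)

text \<open>The level of a point in a late column is contained in its level in an early column, and a level
  that is not the top stays below the top, with the same translation to the next level.\<close>
lemma descend: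
  assumes "x \<in> lev n i" "i < h n" "n \<le> N"
  obtains j where "i \<le> j" "j < h N" "x \<in> lev N j" "lev N j \<subseteq> lev n i"
    "Suc i < h n \<Longrightarrow> Suc j < h N \<and> lft N (Suc j) - lft N j = lft n (Suc i) - lft n i"
proof -
  have "\<exists>j. i \<le> j \<and> j < h N \<and> x \<in> lev N j \<and> lev N j \<subseteq> lev n i \<and>
    (Suc i < h n \<longrightarrow> Suc j < h N \<and> lft N (Suc j) - lft N j = lft n (Suc i) - lft n i)"
    using assms(3)
  proof (induction N rule: dec_induct)
    case base
    show ?case using assms by auto
  next
    case (step N)
    then obtain j where j: "i \<le> j" "j < h N" "x \<in> lev N j" "lev N j \<subseteq> lev n i"
      "Suc i < h n \<Longrightarrow> Suc j < h N \<and> lft N (Suc j) - lft N j = lft n (Suc i) - lft n i"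
      by blast
    from j(2,3) lev_split[of j N] obtain a where
      a: "a \<in> digits N" "x \<in> lev (Suc N) (a + j)" "lev (Suc N) (a + j) \<subseteq> lev N j" by auto
    show ?case
      using j a digit_add_less[OF a(1), of j] digit_add_less[OF a(1), of "Suc j"]
        lft_digit_add_diff[OF a(1), of "Suc j" j]
      by (intro exI[of _ "a + j"]) auto
  qed
  with that show ?thesis by blast
qed

section \<open>The transformation on its space\<close>

lemma X_iff: "x \<in> X \<longleftrightarrow> (\<exists>n. \<exists>i<h n. x \<in> lev n i)"
  by (auto simp: X_def rank_one_space_def col_union_def h_def lev_def)

lemma lev_subset_X: "i < h n \<Longrightarrow> lev n i \<subseteq> X"
  unfolding subset_iff X_iff by blast

lemma column_map_lev:
  assumes "x \<in> lev n i" "Suc i < h n"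
  shows "column_map (columns r S n) x = x - lft n i + lft n (Suc i)"
proof -
  have "(THE i. Suc i < h n \<and> x \<in> lev n i) = i"
    using assms by (intro the_equality) (auto intro: lev_unique)
  with assms show ?thesis
    by (auto simp: column_map_def Let_def h_def lev_def lft_def)
qed

lemma T_lev:
  assumes "x \<in> lev n i" "Suc i < h n"
  shows "T x = x - lft n i + lft n (Suc i)"
proof -
  have "column_map (columns r S N) x = x - lft n i + lft n (Suc i)" if nN: "n \<le> N" for N
  proof -
    obtain j where "x \<in> lev N j" "Suc j < h N" "lft N (Suc j) - lft N j = lft n (Suc i) - lft n i"
      using descend[OF assms(1) Suc_lessD[OF assms(2)] nN] assms(2) by metis
    then show ?thesis using column_map_lev[of x N j] by simp
  qed
  then have "(\<lambda>N. column_map (columns r S N) x) \<longlonglongrightarrow> x - lft n i + lft n (Suc i)"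
    by (intro tendsto_eventually eventually_sequentiallyI[of n])
  then show ?thesis
    unfolding T_def rank_one_map_def by (rule limI)
qed

lemma T_lev_Suc: "x \<in> lev n i \<Longrightarrow> Suc i < h n \<Longrightarrow> T x \<in> lev n (Suc i)"
  by (simp add: T_lev lev_eq)

text \<open>A point that sat in the top level of all late columns would always lie in the rightmost piece, at
  distance at most \<open>w n\<close> from a fixed right endpoint. Half-open levels do not contain that endpoint.\<close>
lemma ex_nontop_level:
  assumes "x \<in> X"
  obtains n i where "Suc i < h n" "x \<in> lev n i"
proof -
  from assms obtain n i where n: "i < h n" "x \<in> lev n i" by (auto simp: X_iff)
  \<comment> \<open>The common right endpoint of all the top levels that contain the point.\<close>
  define e where "e = lft n i + w n"
  have "\<exists>N j. Suc j < h N \<and> x \<in> lev N j"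
  proof (rule ccontr)
    assume top: "\<not> ?thesis"
    have "\<exists>j<h N. x \<in> lev N j \<and> lft N j + w N = e" if "n \<le> N" for N
      using that
    proof (induction N rule: dec_induct)
      case base then show ?case using n e_def by auto
    next
      case (step N)
      then obtain j where j: "j < h N" "x \<in> lev N j" "lft N j + w N = e" by auto
      with lev_split[OF j(1)] obtain k where
        k: "k < r N" "x \<in> lev (Suc N) (base N k + j)" by (auto simp: digits_def)
      have "\<not> Suc k < r N"
      proof
        assume "Suc k < r N"
        then have "Suc (base N k + j) < h (Suc N)"
          using base_gap[of k "Suc k" N] base_add_less[of "Suc k" N j] j(1) by linarith
        with k top show False by blast
      qed
      then have "Suc k = r N" using k by simp
      then have "real (r N) = real k + 1" by (metis of_nat_Suc add.commute)
      then have "real k * w (Suc N) + w (Suc N) = w (Suc N) * real (r N)"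
        by (simp add: algebra_simps)
      also have "\<dots> = w N" using r_pos[of N] by (simp add: w_Suc)
      finally have "real k * w (Suc N) + w (Suc N) = w N" .
      then show ?case
        using j k lft_base_add[of k N j] base_add_less[of k N j] by force
    qed
    then have "e - x \<le> w N" if "n \<le> N" for N
      using that by (fastforce simp: lev_eq)
    then have "e - x \<le> 0"
      using w_tendsto_0 by (intro LIMSEQ_le_const[of w]) auto
    then show False using n by (simp add: lev_eq e_def)
  qed
  with that show ?thesis by blast
qed

text \<open>The bottom levels are the intervals \<open>[0, w n)\<close>, which shrink to the point \<open>0\<close>. So \<open>0\<close> is the only
  point without a preimage.\<close>
lemma ex_positive_level:
  assumes "x \<in> X" "x \<noteq> 0"
  obtains n i where "Suc i < h n" "x \<in> lev n (Suc i)"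
proof -
  from assms obtain n i where n: "i < h n" "x \<in> lev n i" by (auto simp: X_iff)
  show ?thesis
  proof (cases "i = 0")
    case False
    then show ?thesis using that[of "i - 1" n] n by simp
  next
    case True
    with n assms have "x > 0" by (simp add: lev_eq lft_bottom)
    then have "\<forall>\<^sub>F N in sequentially. w N < x" using w_tendsto_0 by (rule order_tendstoD(2)[rotated])
    then obtain N where N: "n \<le> N" "w N < x"
      by (metis eventually_sequentially linorder_linear)
    from descend[OF n(2,1) N(1)] obtain j where j: "j < h N" "x \<in> lev N j" by blast
    then have "j \<noteq> 0" using N by (intro notI) (simp add: lev_eq lft_bottom)
    then show ?thesis using that[of "j - 1" N] j by simp
  qed
qed

lemma T_in_X: "x \<in> X \<Longrightarrow> T x \<in> X"
  by (elim ex_nontop_level) (auto simp: X_iff intro: T_lev_Suc)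

lemma inj_on_T: "inj_on T X"
proof (rule inj_onI)
  fix x y assume "x \<in> X" "y \<in> X" and eq: "T x = T y"
  then obtain n i m j where n: "Suc i < h n" "x \<in> lev n i" and m: "Suc j < h m" "y \<in> lev m j"
    by (elim ex_nontop_level)
  obtain i' where i': "Suc i' < h (max n m)" "x \<in> lev (max n m) i'"
    using descend[OF n(2) Suc_lessD[OF n(1)], of "max n m"] n(1) by auto
  obtain j' where j': "Suc j' < h (max n m)" "y \<in> lev (max n m) j'"
    using descend[OF m(2) Suc_lessD[OF m(1)], of "max n m"] m(1) by auto
  note ij = i' j'
  have "Suc i' = Suc j'"
    using T_lev_Suc[of x _ i'] T_lev_Suc[of y _ j'] ij eq by (metis lev_unique)
  with ij eq show "x = y" by (simp add: T_lev)
qed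

end

section \<open>Lebesgue measure: translations and products of subspaces\<close>

lemma emeasure_lborel_vimage_plus:
  fixes B :: "'a::euclidean_space set"
  assumes "B \<in> sets borel"
  shows "emeasure lborel ((+) c -` B) = emeasure lborel B"
proof -
  have "emeasure lborel B = emeasure (distr lborel borel ((+) c)) B" by (simp add: lborel_distr_plus)
  also have "\<dots> = emeasure lborel ((+) c -` B \<inter> space lborel)"
    by (rule emeasure_distr) (use assms in auto)
  finally show ?thesis by simp
qed

lemma measure_le_of_translate_into:
  fixes B B' :: "'a::euclidean_space set"
  assumes "B \<in> sets borel" "B' \<in> fmeasurable lborel" "\<And>p. p \<in> B \<Longrightarrow> c + p \<in> B'"
  shows "measure lborel B \<le> measure lborel B'"
proof -
  have B': "B' \<in> sets borel" "emeasure lborel B' < \<infinity>" using assms(2) by (auto simp: fmeasurable_def)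
  have "(+) c -` B' \<in> sets borel" using B'(1) by (intro measurable_sets_borel[of _ borel]) auto
  then have "(+) c -` B' \<in> fmeasurable lborel"
    using B' emeasure_lborel_vimage_plus[OF B'(1), of c] by (simp add: fmeasurable_def)
  then have "measure lborel B \<le> measure lborel ((+) c -` B')"
    by (intro measure_mono_fmeasurable) (use assms in auto)
  also have "\<dots> = measure lborel B'"
    by (simp add: measure_def emeasure_lborel_vimage_plus[OF B'(1)])
  finally show ?thesis .
qed

text \<open>This and the next lemma move the whole argument from the product of two restricted measures to
  Lebesgue measure on the plane.\<close>
lemma sets_pair_restrict_lborel_iff:
  fixes X :: "'a::euclidean_space set" and Y :: "'b::euclidean_space set"
  assumes "X \<in> sets borel" "Y \<in> sets borel"
  shows "A \<in> sets (restrict_space lborel X \<Otimes>\<^sub>M restrict_space lborel Y)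
    \<longleftrightarrow> A \<in> sets borel \<and> A \<subseteq> X \<times> Y"
proof
  let ?P = "restrict_space lborel X \<Otimes>\<^sub>M restrict_space lborel Y"
  have sp: "space ?P = X \<times> Y" by (simp add: space_pair_measure space_restrict_space)
  {
    assume A: "A \<in> sets ?P"
    have "sets ?P \<subseteq> sets (borel :: ('a \<times> 'b) measure)"
      using assms by (intro sets_pair_in_sets) (auto simp: sets_restrict_space borel_Times)
    with A sets.sets_into_space[OF A] show "A \<in> sets borel \<and> A \<subseteq> X \<times> Y"
      by (auto simp: sp)
  next
    assume A: "A \<in> sets borel \<and> A \<subseteq> X \<times> Y"
    have "(\<lambda>p. (fst p, snd p)) \<in> ?P \<rightarrow>\<^sub>M (borel :: ('a \<times> 'b) measure)"
      unfolding borel_prod[symmetric]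
      by (intro measurable_Pair measurable_compose[OF measurable_fst] measurable_compose[OF measurable_snd])
         (auto intro: measurable_restrict_space1)
    then have "(\<lambda>p. (fst p, snd p)) -` A \<inter> space ?P \<in> sets ?P"
      using A by (intro measurable_sets) auto
    also have "(\<lambda>p. (fst p, snd p)) -` A \<inter> space ?P = A" using A sp by auto
    finally show "A \<in> sets ?P" .
  }
qed

lemma emeasure_pair_restrict_lborel:
  fixes X :: "'a::euclidean_space set" and Y :: "'b::euclidean_space set"
  assumes "X \<in> sets borel" "Y \<in> sets borel" "A \<in> sets borel" "A \<subseteq> X \<times> Y"
  shows "emeasure (restrict_space lborel X \<Otimes>\<^sub>M restrict_space lborel Y) A = emeasure lborel A"
proof -
  let ?MX = "restrict_space lborel X" and ?MY = "restrict_space lborel Y"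
  interpret Y: sigma_finite_measure ?MY
    using assms(2) by (intro sigma_finite_measure_restrict_space sigma_finite_lborel) auto
  have A: "A \<in> sets (lborel \<Otimes>\<^sub>M lborel)"
    using assms(3) unfolding lborel_prod by simp
  have "emeasure (?MX \<Otimes>\<^sub>M ?MY) A = (\<integral>\<^sup>+x. emeasure ?MY (Pair x -` A) \<partial>?MX)"
    using assms by (intro Y.emeasure_pair_measure_alt) (auto simp: sets_pair_restrict_lborel_iff)
  also have "\<dots> = (\<integral>\<^sup>+x. emeasure ?MY (Pair x -` A) * indicator X x \<partial>lborel)"
    using assms(1) by (intro nn_integral_restrict_space) auto
  also have "\<dots> = (\<integral>\<^sup>+x. emeasure lborel (Pair x -` A) \<partial>lborel)"
  proof (intro nn_integral_cong)
    fix x :: 'a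
    have "Pair x -` A = {}" if "x \<notin> X" using assms(4) that by auto
    moreover have "emeasure ?MY (Pair x -` A) = emeasure lborel (Pair x -` A)"
      using assms by (intro emeasure_restrict_space) auto
    ultimately show "emeasure ?MY (Pair x -` A) * indicator X x = emeasure lborel (Pair x -` A)"
      by (auto simp: indicator_def)
  qed
  also have "\<dots> = emeasure (lborel \<Otimes>\<^sub>M lborel) A"
    by (intro lborel.emeasure_pair_measure_alt[symmetric] A)
  finally show ?thesis by (simp add: lborel_prod)
qed

section \<open>Rectangles of levels\<close>

context rank_one_system
begin

definition rect :: "nat \<Rightarrow> nat \<Rightarrow> nat \<Rightarrow> (real \<times> real) set" where
  "rect n i j = lev n i \<times> lev n j"

lemma rect_iff: "p \<in> rect n i j \<longleftrightarrow> fst p \<in> lev n i \<and> snd p \<in> lev n j"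
  by (cases p) (simp add: rect_def)

lemma rect_unique:
  "p \<in> rect n i j \<Longrightarrow> p \<in> rect n i' j' \<Longrightarrow> i < h n \<Longrightarrow> j < h n \<Longrightarrow> i' < h n \<Longrightarrow> j' < h n
    \<Longrightarrow> i = i' \<and> j = j'"
  using lev_unique[of "fst p" n i i'] lev_unique[of "snd p" n j j'] by (simp add: rect_iff)

lemma lev_borel: "lev n i \<in> sets borel" by (simp add: lev_eq)

lemma X_borel: "X \<in> sets borel"
proof -
  have "X = (\<Union>n. \<Union>i<h n. lev n i)" unfolding set_eq_iff X_iff by blast
  then show ?thesis using lev_borel by auto
qed

lemma rect_borel [measurable]: "rect n i j \<in> sets borel"
  unfolding rect_def by (intro borel_Times lev_borel)

lemma emeasure_rect: "emeasure lborel (rect n i j) = ennreal ((w n)\<^sup>2)"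
proof -
  have "emeasure lborel (rect n i j) = emeasure (lborel \<Otimes>\<^sub>M lborel) (lev n i \<times> lev n j)"
    by (simp add: lborel_prod rect_def)
  also have "\<dots> = emeasure lborel (lev n i) * emeasure lborel (lev n j)"
    by (intro lborel.emeasure_pair_measure_Times) (auto simp: lev_borel)
  also have "\<dots> = ennreal ((w n)\<^sup>2)"
    using w_pos[of n] by (simp add: lev_eq ennreal_mult' power2_eq_square)
  finally show ?thesis .
qed

lemma measure_rect: "measure lborel (rect n i j) = (w n)\<^sup>2"
  by (simp add: measure_def emeasure_rect)

lemma rect_fmeasurable: "rect n i j \<in> fmeasurable lborel"
  by (intro fmeasurableI) (auto simp: emeasure_rect rect_borel)

lemma inter_rect_fmeasurable: "B \<in> sets borel \<Longrightarrow> B \<inter> rect n i j \<in> fmeasurable lborel"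
  by (rule fmeasurableI2[OF rect_fmeasurable]) auto

lemma measure_inter_rects:
  assumes "B \<in> sets borel" "finite P" "P \<subseteq> {..<h n} \<times> {..<h n}"
  shows "measure lborel (B \<inter> (\<Union>(i,j)\<in>P. rect n i j)) = (\<Sum>(i,j)\<in>P. measure lborel (B \<inter> rect n i j))"
proof -
  have "B \<inter> (\<Union>(i,j)\<in>P. rect n i j) = (\<Union>p\<in>P. B \<inter> rect n (fst p) (snd p))" by auto
  moreover have "measure lborel (\<Union>p\<in>P. B \<inter> rect n (fst p) (snd p))
    = (\<Sum>p\<in>P. measure lborel (B \<inter> rect n (fst p) (snd p)))"
  proof (rule measure_finite_Union)
    show "disjoint_family_on (\<lambda>p. B \<inter> rect n (fst p) (snd p)) P"
    proof (unfold disjoint_family_on_def, intro ballI impI)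
      fix p q assume pq: "p \<in> P" "q \<in> P" "p \<noteq> q"
      have "fst p < h n" "snd p < h n" "fst q < h n" "snd q < h n"
        using pq assms(3) by auto
      then have "z \<notin> rect n (fst q) (snd q)" if "z \<in> rect n (fst p) (snd p)" for z
        using rect_unique[OF that] pq(3) prod_eqI by blast
      then show "B \<inter> rect n (fst p) (snd p) \<inter> (B \<inter> rect n (fst q) (snd q)) = {}"
        by blast
    qed
    show "emeasure lborel (B \<inter> rect n (fst p) (snd p)) \<noteq> \<infinity>" for p
      using inter_rect_fmeasurable[OF assms(1)] by (simp add: fmeasurable_def less_top)
  qed (use assms in auto)
  ultimately show ?thesis by (simp add: case_prod_unfold)
qed

lemma rect_split:
  assumes "i < h n" "j < h n"
  shows "rect n i j = (\<Union>(a,b)\<in>digits n \<times> digits n. rect (Suc n) (a + i) (b + j))"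
  unfolding rect_def lev_split[OF assms(1)] lev_split[OF assms(2)] by auto

lemma measure_inter_rect_split:
  assumes "B \<in> sets borel" "i < h n" "j < h n"
  shows "measure lborel (B \<inter> rect n i j)
    = (\<Sum>(a,b)\<in>digits n \<times> digits n. measure lborel (B \<inter> rect (Suc n) (a + i) (b + j)))"
proof -
  let ?D = "digits n \<times> digits n" and ?f = "\<lambda>(a,b). (a + i, b + j)"
  have inj: "inj_on ?f ?D" by (auto simp: inj_on_def)
  have "rect n i j = (\<Union>(i,j)\<in>?f ` ?D. rect (Suc n) i j)"
    using rect_split[OF assms(2,3)] by auto
  then have "measure lborel (B \<inter> rect n i j)
      = (\<Sum>(i,j)\<in>?f ` ?D. measure lborel (B \<inter> rect (Suc n) i j))"
    using assms digit_add_less finite_digits by (simp only:) (intro measure_inter_rects, auto)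
  also have "\<dots> = (\<Sum>(a,b)\<in>?D. measure lborel (B \<inter> rect (Suc n) (a + i) (b + j)))"
    by (subst sum.reindex[OF inj]) (simp add: case_prod_unfold)
  finally show ?thesis .
qed

lemma measure_rect_minus:
  assumes "A \<in> sets borel" "i < h n" "j < h n"
  shows "measure lborel ((X \<times> X - A) \<inter> rect n i j) = (w n)\<^sup>2 - measure lborel (A \<inter> rect n i j)"
proof -
  have "rect n i j \<subseteq> X \<times> X" using assms lev_subset_X by (auto simp: rect_def)
  then have "(X \<times> X - A) \<inter> rect n i j = rect n i j - A \<inter> rect n i j" by auto
  then show ?thesis
    using inter_rect_fmeasurable[OF assms(1)] rect_fmeasurable assms(1)
    by (simp add: measure_Diff measure_rect fmeasurable_def less_top emeasure_rect)
qed

definition col :: "nat \<Rightarrow> real set" where "col n = (\<Union>i<h n. lev n i)"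

lemma col_mono: "n \<le> m \<Longrightarrow> col n \<subseteq> col m"
  unfolding col_def by (auto elim: descend)

lemma X_eq: "X = (\<Union>n. col n)" unfolding set_eq_iff X_iff col_def by blast

lemma col_Times: "col n \<times> col n = (\<Union>(i,j)\<in>{..<h n} \<times> {..<h n}. rect n i j)"
  by (auto simp: col_def rect_def)

lemma col_Times_fmeasurable: "col n \<times> col n \<in> fmeasurable lborel"
  unfolding col_Times by (intro fmeasurable.finite_UN) (auto simp: rect_fmeasurable)

lemma ex_small_rect:
  assumes "open G" "p \<in> G" "p \<in> col m \<times> col m"
  obtains N i j where "m \<le> N" "i < h N" "j < h N" "p \<in> rect N i j" "rect N i j \<subseteq> G"
proof -
  obtain e where e: "e > 0" "ball p e \<subseteq> G" using assms(1,2) openE by blast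
  have "\<forall>\<^sub>F N in sequentially. w N < e / 2"
    using w_tendsto_0 e(1) by (intro order_tendstoD(2)[where y=0]) auto
  then obtain N where N: "m \<le> N" "w N < e / 2"
    by (metis eventually_sequentially linorder_linear)
  have "p \<in> col N \<times> col N" using assms(3) col_mono[OF N(1)] by auto
  then obtain i j where ij: "i < h N" "j < h N" "p \<in> rect N i j" by (auto simp: col_Times)
  have "dist p q < e" if "q \<in> rect N i j" for q
  proof -
    have "dist p q \<le> \<bar>fst p - fst q\<bar> + \<bar>snd p - snd q\<bar>"
      using sqrt_sum_squares_le_sum_abs by (simp add: dist_prod_def dist_real_def)
    also have "\<dots> \<le> w N + w N"
      using that ij by (intro add_mono) (auto simp: rect_iff lev_eq)
    finally show ?thesis using N by simp
  qed
  then have "rect N i j \<subseteq> G" using e(2) by auto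
  with that N ij show ?thesis by blast
qed

text \<open>A one-sided substitute for the Lebesgue density theorem along the rectangles. If \<open>K\<close> is the part
  of \<open>B\<close> over one column and \<open>G\<close> is an open set around \<open>K\<close> of nearly the same measure, then the
  rectangles inside \<open>G\<close> exhaust \<open>K\<close>, and summing the density bound over them shows that \<open>K\<close> has at
  most \<open>c\<close> times the measure of \<open>G\<close>. As \<open>c < 1\<close>, the measure of \<open>K\<close> vanishes.\<close>
lemma null_if_density_bounded:
  assumes B: "B \<in> sets borel" "B \<subseteq> X \<times> X" and c: "0 \<le> c" "c < 1"
    and density: "\<And>N i j. n \<le> N \<Longrightarrow> i < h N \<Longrightarrow> j < h N \<Longrightarrow>
      measure lborel (B \<inter> rect N i j) \<le> c * (w N)\<^sup>2"
  shows "B \<in> null_sets lborel"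
proof -
  have null: "B \<inter> (col m \<times> col m) \<in> null_sets lborel" if "n \<le> m" for m
  proof -
    define K where "K = B \<inter> (col m \<times> col m)"
    have "K \<in> fmeasurable lborel"
      unfolding K_def using B(1) col_Times_fmeasurable
      by (intro fmeasurableI2[OF col_Times_fmeasurable[of m]]) (auto simp: fmeasurable_def)
    then have K: "K \<in> fmeasurable lborel" "K \<in> sets borel" by (auto simp: fmeasurable_def)
    have "measure lborel K \<le> c * measure lborel K + \<epsilon>" if "\<epsilon> > 0" for \<epsilon>
    proof -
      obtain G where G: "open G" "K \<subseteq> G" "emeasure lborel (G - K) < \<epsilon>"
        using outer_regular_lborel[OF K(2) \<open>\<epsilon> > 0\<close>] by blast
      have GK: "G - K \<in> fmeasurable lborel"
        using G K(2) by (intro fmeasurableI) (auto intro: less_trans)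
      have "G = K \<union> (G - K)" using G(2) by auto
      then have Gf: "G \<in> fmeasurable lborel" using fmeasurable.Un[OF K(1) GK] by simp
      have "measure lborel G = measure lborel K + measure lborel (G - K)"
        using measure_Union[of lborel K "G - K"] K GK \<open>G = K \<union> (G - K)\<close>
        by (auto simp: fmeasurable_def less_top)
      moreover have "measure lborel (G - K) \<le> \<epsilon>"
        using G(3) GK that by (auto simp: emeasure_eq_measure2 ennreal_less_iff)
      ultimately have mG: "measure lborel G \<le> measure lborel K + \<epsilon>" by simp
      define I where "I = (\<lambda>N. {(i,j). i < h N \<and> j < h N \<and> rect N i j \<subseteq> G})"
      define U where "U = (\<lambda>N. \<Union>(i,j)\<in>I N. rect N i j)"
      have I: "finite (I N)" "I N \<subseteq> {..<h N} \<times> {..<h N}" for N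
      proof -
        show "I N \<subseteq> {..<h N} \<times> {..<h N}" by (auto simp: I_def)
        then show "finite (I N)" by (rule finite_subset) auto
      qed
      have Uf: "U N \<in> sets borel" "U N \<subseteq> G" for N
        using I[of N] unfolding U_def by (auto simp: I_def)
      have bound: "measure lborel (K \<inter> U N) \<le> c * measure lborel G" if "m \<le> N" for N
      proof -
        have "measure lborel (K \<inter> U N) = (\<Sum>(i,j)\<in>I N. measure lborel (K \<inter> rect N i j))"
          unfolding U_def by (rule measure_inter_rects[OF K(2) I])
        also have "\<dots> \<le> (\<Sum>(i,j)\<in>I N. c * (w N)\<^sup>2)"
        proof (rule sum_mono, clarify)
          fix i j assume "(i, j) \<in> I N"
          then have ij: "i < h N" "j < h N" by (auto simp: I_def)
          have "measure lborel (K \<inter> rect N i j) \<le> measure lborel (B \<inter> rect N i j)"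
            using inter_rect_fmeasurable[OF B(1)] K(2)
            by (intro measure_mono_fmeasurable) (auto simp: K_def)
          with density[OF _ ij] that \<open>n \<le> m\<close>
          show "measure lborel (K \<inter> rect N i j) \<le> c * (w N)\<^sup>2" by fastforce
        qed
        also have "\<dots> = c * (\<Sum>(i,j)\<in>I N. measure lborel (UNIV \<inter> rect N i j))"
          by (simp add: measure_rect case_prod_unfold)
        also have "(\<Sum>(i,j)\<in>I N. measure lborel (UNIV \<inter> rect N i j)) = measure lborel (UNIV \<inter> U N)"
          unfolding U_def by (rule measure_inter_rects[symmetric, OF _ I]) auto
        also have "\<dots> \<le> measure lborel G"
          using Uf Gf by (intro measure_mono_fmeasurable) auto
        finally show ?thesis using c by (simp add: mult_left_mono)
      qed
      have "U N \<subseteq> U (Suc N)" for N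
      proof
        fix p assume "p \<in> U N"
        then obtain i j where ij: "i < h N" "j < h N" "rect N i j \<subseteq> G" "p \<in> rect N i j"
          by (auto simp: U_def I_def)
        from ij(4) obtain a b where ab: "a \<in> digits N" "b \<in> digits N"
          "p \<in> rect (Suc N) (a + i) (b + j)" by (auto simp: rect_split[OF ij(1,2)])
        moreover have "rect (Suc N) (a + i) (b + j) \<subseteq> rect N i j"
          using ab by (auto simp: rect_split[OF ij(1,2)])
        ultimately show "p \<in> U (Suc N)"
          using ij digit_add_less unfolding U_def I_def by blast
      qed
      then have inc: "incseq (\<lambda>k. K \<inter> U (m + k))" by (intro incseq_SucI) auto
      have "K \<subseteq> (\<Union>k. K \<inter> U (m + k))"
      proof
        fix p assume p: "p \<in> K"
        then have "p \<in> G" "p \<in> col m \<times> col m" using G by (auto simp: K_def)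
        with G(1) obtain N i j where "m \<le> N" "i < h N" "j < h N" "p \<in> rect N i j" "rect N i j \<subseteq> G"
          by (elim ex_small_rect)
        then have "p \<in> U (m + (N - m))" by (auto simp: U_def I_def)
        with p show "p \<in> (\<Union>k. K \<inter> U (m + k))" by blast
      qed
      then have "(\<Union>k. K \<inter> U (m + k)) = K" by auto
      with Lim_measure_incseq[OF _ inc, of lborel] K Uf
      have "(\<lambda>k. measure lborel (K \<inter> U (m + k))) \<longlonglongrightarrow> measure lborel K"
        by (auto simp: fmeasurable_def less_top)
      then have "measure lborel K \<le> c * measure lborel G"
        by (rule LIMSEQ_le_const2) (use bound in auto)
      also have "\<dots> \<le> c * measure lborel K + c * \<epsilon>"
        using mG c by (simp flip: distrib_left add: mult_left_mono)
      also have "c * \<epsilon> \<le> \<epsilon>" using c \<open>\<epsilon> > 0\<close> by simp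
      finally show ?thesis by simp
    qed
    then have "measure lborel K \<le> c * measure lborel K" by (rule field_le_epsilon)
    then have "(1 - c) * measure lborel K \<le> 0" by (simp add: algebra_simps)
    then have "measure lborel K \<le> 0" using c by (simp add: mult_le_0_iff)
    then have "measure lborel K = 0" by (simp add: antisym)
    with K have "K \<in> null_sets lborel"
      by (intro null_setsI) (auto simp: emeasure_eq_measure2)
    then show ?thesis by (simp add: K_def)
  qed
  have "B \<subseteq> (\<Union>k. B \<inter> (col (n + k) \<times> col (n + k)))"
  proof
    fix p assume p: "p \<in> B"
    with B(2) obtain m m' where "fst p \<in> col m" "snd p \<in> col m'" by (auto simp: X_eq)
    then have "p \<in> col (n + (m + m')) \<times> col (n + (m + m'))"
      using col_mono[of m "n + (m + m')"] col_mono[of m' "n + (m + m')"] by (cases p) auto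
    with p show "p \<in> (\<Union>k. B \<inter> (col (n + k) \<times> col (n + k)))" by blast
  qed
  then have "B = (\<Union>k. B \<inter> (col (n + k) \<times> col (n + k)))" by auto
  moreover have "(\<Union>k. B \<inter> (col (n + k) \<times> col (n + k))) \<in> null_sets lborel"
    using null by (intro null_sets_UN) auto
  ultimately show ?thesis by simp
qed

end

section \<open>Reachable heights and partnered digits\<close>

context rank_one_system
begin

text \<open>The heights in column \<open>n\<close> of the pieces of the unit interval, that is, the Minkowski sum of the
  first \<open>n\<close> height sets.\<close>
primrec reach :: "nat \<Rightarrow> nat set" where
  "reach 0 = {0}"
| "reach (Suc n) = (\<Union>a\<in>digits n. (+) a ` reach n)"

lemma reach_less: "i \<in> reach n \<Longrightarrow> i < h n"
  by (induction n arbitrary: i) (auto simp: h_0 digit_add_less)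

lemma finite_reach: "finite (reach n)"
  by (rule finite_subset[of _ "{..<h n}"]) (auto simp: reach_less)

lemma height_set_eq_digits: "height_set r S n = int ` digits n"
proof -
  have base_int: "(\<Sum>k=0..i. int (subcolumn_height r S n k)) = int (base n (Suc i))" for i
    by (simp add: base_def atLeast0AtMost lessThan_Suc_atMost)
  have "{..<r n} = insert 0 (Suc ` {..<r n - 1})"
    using r_pos[of n] by (simp flip: lessThan_Suc_eq_insert_0)
  then have "digits n = insert 0 ((\<lambda>i. base n (Suc i)) ` {..<r n - 1})"
    by (simp add: digits_def base_0 image_image)
  then show ?thesis
    by (auto simp: height_set_def base_int)
qed

lemma sum_height_sets: "(\<Sum>i<n. height_set r S i) = int ` reach n"
proof (induction n)
  case (Suc n)
  have "(\<Sum>i<Suc n. height_set r S i) = int ` reach n + int ` digits n"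
    using Suc by (simp add: height_set_eq_digits)
  also have "\<dots> = int ` reach (Suc n)"
  proof (intro set_eqI iffI)
    fix x assume "x \<in> int ` reach n + int ` digits n"
    then obtain i a where "i \<in> reach n" "a \<in> digits n" "x = int (a + i)"
      by (auto simp: set_plus_def add.commute)
    then show "x \<in> int ` reach (Suc n)" by (intro image_eqI[of _ _ "a + i"]) auto
  next
    fix x assume "x \<in> int ` reach (Suc n)"
    then obtain i a where "i \<in> reach n" "a \<in> digits n" "x = int i + int a" by auto
    then show "x \<in> int ` reach n + int ` digits n" by (auto intro: set_plus_intro)
  qed
  finally show ?case .
qed auto

lemma reach_le_Max: "i \<in> reach n \<Longrightarrow> int i \<le> Max (\<Sum>i<n. height_set r S i)"
  unfolding sum_height_sets by (intro Max_ge) (auto simp: finite_reach)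

end

text \<open>The form in which the construction of the height sets is used. \<open>U\<close> and \<open>L\<close> collect the members
  of the upper and of the lower pairs. All upper pairs have the same sum \<open>\<sigma> n\<close> and all lower pairs
  the sum \<open>\<sigma> n + 1\<close>, so the partner of a digit is found by reflection. The last assumption is the
  combinatorial core: two digits that are not partners can be recovered, up to order, from the sum of two
  reachable heights of the next column, because the lower digits change that sum by less than the
  constant \<open>M\<close> of the construction.\<close>
locale paired_rank_one_system = rank_one_system +
  fixes \<gamma> :: "nat \<Rightarrow> nat" and U L :: "nat \<Rightarrow> nat set" and \<sigma> :: "nat \<Rightarrow> nat"
  assumes digits_eq: "digits n = U n \<union> L n"
    and U_L_disjoint: "U n \<inter> L n = {}"
    and card_U: "card (U n) = 2 * \<gamma> n"
    and card_L: "card (L n) = 2 * \<gamma> n"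
    and \<gamma>_pos: "0 < \<gamma> n"
    and U_partner: "a \<in> U n \<Longrightarrow> a \<le> \<sigma> n \<and> \<sigma> n - a \<in> U n"
    and L_partner: "a \<in> L n \<Longrightarrow> a \<le> Suc (\<sigma> n) \<and> Suc (\<sigma> n) - a \<in> L n"
    and rigid: "\<lbrakk>a \<in> digits n; b \<in> digits n; a' \<in> digits n; b' \<in> digits n;
        i \<in> reach n; j \<in> reach n; i' \<in> reach n; j' \<in> reach n;
        (a + i) + (b + j) = (a' + i') + (b' + j');
        \<not> (a \<in> U n \<and> a + b = \<sigma> n); \<not> (a \<in> L n \<and> a + b = Suc (\<sigma> n))\<rbrakk>
      \<Longrightarrow> {a, b} = {a', b'}"

text \<open>In three of the four alternatives of the stage condition, the first pair of digits is one of the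
  distinguished pairs.\<close>
lemma stage_condition_unpartnered:
  assumes "stage_condition M H HU HL" "x1 \<in> H" "x2 \<in> H" "x3 \<in> H" "x4 \<in> H"
    "\<bar>x1 + x2 - x3 - x4\<bar> < M" "{x1, x2} \<notin> HU" "{x1, x2} \<notin> HL"
  shows "{x1, x2} = {x3, x4}"
proof -
  have "exactly_one
          [{x1, x2} = {x3, x4},
           {x1, x2} \<noteq> {x3, x4} \<and> x1 + x2 = x3 + x4 \<and>
             ({x1, x2} \<in> HU \<and> {x3, x4} \<in> HU \<or> {x1, x2} \<in> HL \<and> {x3, x4} \<in> HL),
           x1 + x2 = x3 + x4 - 1 \<and> {x1, x2} \<in> HU \<and> {x3, x4} \<in> HL,
           x1 + x2 = x3 + x4 + 1 \<and> {x1, x2} \<in> HL \<and> {x3, x4} \<in> HU]"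
    using assms(1-6) unfolding stage_condition_def by blast
  then obtain k where "k < 4" "[{x1, x2} = {x3, x4}, False, False, False] ! k"
    using assms(7,8) unfolding exactly_one_def by (auto simp: eval_nat_numeral)
  then show ?thesis by (auto simp: less_Suc_eq numeral_eq_Suc)
qed

text \<open>Every upper sum is one less than every lower sum, so all upper sums agree and all lower sums agree.
  This turns the enumerated pairs of the construction into reflections of the two halves.\<close>
lemma (in rank_one_system) ex_pairing:
  assumes "\<And>k. \<gamma> k > 0" "constructed_from \<gamma> \<gamma> r S"
  shows "\<exists>U L \<sigma>. paired_rank_one_system r S \<gamma> U L \<sigma>"
proof -
  define G where "G = (\<lambda>n U L \<sigma>. digits n = U \<union> L \<and> U \<inter> L = {} \<and> card U = 2 * \<gamma> n \<and> card L = 2 * \<gamma> n \<and>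
    (\<forall>a\<in>U. a \<le> \<sigma> \<and> \<sigma> - a \<in> U) \<and> (\<forall>a\<in>L. a \<le> Suc \<sigma> \<and> Suc \<sigma> - a \<in> L) \<and>
    (\<forall>a b a' b' i j i' j'. a \<in> digits n \<and> b \<in> digits n \<and> a' \<in> digits n \<and> b' \<in> digits n \<and>
        i \<in> reach n \<and> j \<in> reach n \<and> i' \<in> reach n \<and> j' \<in> reach n \<and>
        (a + i) + (b + j) = (a' + i') + (b' + j') \<and>
        \<not> (a \<in> U \<and> a + b = \<sigma>) \<and> \<not> (a \<in> L \<and> a + b = Suc \<sigma>) \<longrightarrow> {a, b} = {a', b'}))"
  have "\<exists>U L \<sigma>. G n U L \<sigma>" for n
  proof -
    let ?H = "height_set r S n" and ?I = "{1..\<gamma> n}"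
    obtain M V W v w where
      M: "M > 2 * Max (\<Sum>i<n. height_set r S i) + 1" and
      H: "?H = V ` ?I \<union> W ` ?I \<union> v ` ?I \<union> w ` ?I" and
      card_H: "card ?H = 2 * \<gamma> n + 2 * \<gamma> n" and
      cond: "stage_condition M ?H (pair_set (\<gamma> n) V W) (pair_set (\<gamma> n) v w)"
      using assms(2) unfolding constructed_from_def by metis
    define UU where "UU = V ` ?I \<union> W ` ?I"
    define LL where "LL = v ` ?I \<union> w ` ?I"
    have cU: "card UU \<le> 2 * \<gamma> n" and cL: "card LL \<le> 2 * \<gamma> n"
      unfolding UU_def LL_def
      using card_Un_le[of "V ` ?I" "W ` ?I"] card_Un_le[of "v ` ?I" "w ` ?I"]
        card_image_le[of ?I V] card_image_le[of ?I W] card_image_le[of ?I v] card_image_le[of ?I w]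
      by simp_all
    have fin: "finite UU" "finite LL" by (auto simp: UU_def LL_def)
    have H': "?H = UU \<union> LL" using H by (auto simp: UU_def LL_def)
    \<comment> \<open>All the \<open>V\<close>, \<open>W\<close>, \<open>v\<close>, \<open>w\<close> are distinct, because the height set has the maximal cardinality.\<close>
    have eq: "card UU = 2 * \<gamma> n" "card LL = 2 * \<gamma> n" and "card (UU \<inter> LL) = 0"
      using card_Un_Int[OF fin] card_H cU cL unfolding H' by linarith+
    then have disj: "UU \<inter> LL = {}" using fin by simp
    have sums: "V i + W i = v j + w j - 1" if "i \<in> ?I" "j \<in> ?I" for i j
    proof -
      have "{V i, W i} \<in> pair_set (\<gamma> n) V W" "{v j, w j} \<in> pair_set (\<gamma> n) v w"
        using that by (auto simp: pair_set_def)
      then show ?thesis using cond unfolding stage_condition_def by blast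
    qed
    have nonneg: "x \<ge> 0" if "x \<in> ?H" for x using that by (auto simp: height_set_eq_digits)
    have one: "1 \<in> ?I" using assms(1)[of n] by simp
    define \<sigma> where "\<sigma> = nat (V 1 + W 1)"
    have \<sigma>: "int \<sigma> = V 1 + W 1"
      using nonneg[of "V 1"] nonneg[of "W 1"] one H unfolding \<sigma>_def by auto
    have sum_VW: "V i + W i = int \<sigma>" if "i \<in> ?I" for i
      using sums[OF that one] sums[OF one one] \<sigma> by simp
    have sum_vw: "v i + w i = int \<sigma> + 1" if "i \<in> ?I" for i
      using sums[OF one that] \<sigma> by simp
    have refl_UU: "int \<sigma> - x \<in> UU" if "x \<in> UU" for x
    proof -
      from that obtain i where i: "i \<in> ?I" "x = V i \<or> x = W i" by (auto simp: UU_def)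
      then have "int \<sigma> - x = W i \<or> int \<sigma> - x = V i" using sum_VW[of i] by auto
      with i(1) show ?thesis by (auto simp: UU_def)
    qed
    have refl_LL: "int (Suc \<sigma>) - x \<in> LL" if "x \<in> LL" for x
    proof -
      from that obtain i where i: "i \<in> ?I" "x = v i \<or> x = w i" by (auto simp: LL_def)
      then have "int (Suc \<sigma>) - x = w i \<or> int (Suc \<sigma>) - x = v i" using sum_vw[of i] by auto
      with i(1) show ?thesis by (auto simp: LL_def)
    qed
    have H_nat: "int (nat x) = x" "nat x \<in> digits n" if "x \<in> ?H" for x
      using that by (auto simp: height_set_eq_digits)
    have UU_int: "int ` nat ` UU = UU" and LL_int: "int ` nat ` LL = LL"
      using H_nat(1) H' by (auto simp: image_image)
    have inj: "inj_on nat ?H" using H_nat(1) by (metis inj_onI)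
    have mem: "int a \<in> UU \<longleftrightarrow> a \<in> nat ` UU" "int a \<in> LL \<longleftrightarrow> a \<in> nat ` LL" for a
      using UU_int LL_int by (metis image_eqI nat_int, metis image_eqI imageE nat_int of_nat_eq_iff)+
    have sub: "a \<le> s \<and> s - a \<in> nat ` Q" if "int s - int a \<in> Q" "Q \<subseteq> ?H" for a s Q
    proof -
      have "int s - int a \<ge> 0" using that by (intro nonneg) auto
      then have "a \<le> s" by linarith
      moreover from this have "s - a = nat (int s - int a)" by (simp add: nat_diff_distrib)
      ultimately show ?thesis using that by auto
    qed
    show ?thesis
      unfolding G_def
    proof (rule exI[of _ "nat ` UU"], rule exI[of _ "nat ` LL"], rule exI[of _ \<sigma>], intro conjI ballI allI impI)
      show "digits n = nat ` UU \<union> nat ` LL"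
      proof -
        have "digits n = nat ` ?H" by (simp add: height_set_eq_digits image_image)
        then show ?thesis by (simp add: H' image_Un)
      qed
      show "nat ` UU \<inter> nat ` LL = {}"
        using inj_on_image_Int[OF inj, of UU LL] H' disj by auto
      show "card (nat ` UU) = 2 * \<gamma> n" "card (nat ` LL) = 2 * \<gamma> n"
        using inj_on_subset[OF inj] H' eq by (auto simp: card_image)
    next
      fix a assume "a \<in> nat ` UU"
      then have "int a \<in> UU" by (simp add: mem)
      then have "int \<sigma> - int a \<in> UU" by (rule refl_UU)
      then show "a \<le> \<sigma>" "\<sigma> - a \<in> nat ` UU" using sub[of \<sigma> a UU] H' by auto
    next
      fix a assume "a \<in> nat ` LL"
      then have "int a \<in> LL" by (simp add: mem)
      then have "int (Suc \<sigma>) - int a \<in> LL" by (rule refl_LL)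
      then show "a \<le> Suc \<sigma>" "Suc \<sigma> - a \<in> nat ` LL" using sub[of "Suc \<sigma>" a LL] H' by auto
    next
      fix a b a' b' i j i' j' :: nat
      assume *: "a \<in> digits n \<and> b \<in> digits n \<and> a' \<in> digits n \<and> b' \<in> digits n \<and>
        i \<in> reach n \<and> j \<in> reach n \<and> i' \<in> reach n \<and> j' \<in> reach n \<and>
        (a + i) + (b + j) = (a' + i') + (b' + j') \<and>
        \<not> (a \<in> nat ` UU \<and> a + b = \<sigma>) \<and> \<not> (a \<in> nat ` LL \<and> a + b = Suc \<sigma>)"
      have "int a + int b - int a' - int b' = int i' + int j' - int i - int j"
        using * by linarith
      moreover have "int i \<le> Max (\<Sum>i<n. height_set r S i)" "int j \<le> Max (\<Sum>i<n. height_set r S i)"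
        "int i' \<le> Max (\<Sum>i<n. height_set r S i)" "int j' \<le> Max (\<Sum>i<n. height_set r S i)"
        using * reach_le_Max by blast+
      ultimately have small: "\<bar>int a + int b - int a' - int b'\<bar> < M" using M by linarith
      have mH: "int a \<in> ?H" "int b \<in> ?H" "int a' \<in> ?H" "int b' \<in> ?H"
        using * by (auto simp: height_set_eq_digits)
      have "{int a, int b} \<notin> pair_set (\<gamma> n) V W"
      proof
        assume "{int a, int b} \<in> pair_set (\<gamma> n) V W"
        then obtain k where k: "k \<in> ?I" "{int a, int b} = {V k, W k}" by (auto simp: pair_set_def)
        then have "int a \<in> UU" "int a + int b = int \<sigma>"
          using sum_VW[OF k(1)] unfolding UU_def by (auto simp: doubleton_eq_iff)
        then show False using * by (metis mem(1) of_nat_add of_nat_eq_iff)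
      qed
      moreover have "{int a, int b} \<notin> pair_set (\<gamma> n) v w"
      proof
        assume "{int a, int b} \<in> pair_set (\<gamma> n) v w"
        then obtain k where k: "k \<in> ?I" "{int a, int b} = {v k, w k}" by (auto simp: pair_set_def)
        then have "int a \<in> LL" "int a + int b = int (Suc \<sigma>)"
          using sum_vw[OF k(1)] unfolding LL_def by (auto simp: doubleton_eq_iff)
        then show False using * by (metis mem(2) of_nat_add of_nat_eq_iff)
      qed
      ultimately have "{int a, int b} = {int a', int b'}"
        using stage_condition_unpartnered[OF cond mH small] by blast
      then show "{a, b} = {a', b'}" by (auto simp: doubleton_eq_iff)
    qed
  qed
  then obtain U L \<sigma> where G: "\<And>n. G n (U n) (L n) (\<sigma> n)" by metis
  have "paired_rank_one_system r S \<gamma> U L \<sigma>"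
  proof
    fix n
    note g = G[of n, unfolded G_def]
    note g3 = g[THEN conjunct2, THEN conjunct2, THEN conjunct2, THEN conjunct2]
    show "digits n = U n \<union> L n" by (rule g[THEN conjunct1])
    show "U n \<inter> L n = {}" by (rule g[THEN conjunct2, THEN conjunct1])
    show "card (U n) = 2 * \<gamma> n" by (rule g[THEN conjunct2, THEN conjunct2, THEN conjunct1])
    show "card (L n) = 2 * \<gamma> n"
      by (rule g[THEN conjunct2, THEN conjunct2, THEN conjunct2, THEN conjunct1])
    show "0 < \<gamma> n" by (rule assms(1))
    show "a \<le> \<sigma> n \<and> \<sigma> n - a \<in> U n" if "a \<in> U n" for a
      using g3[THEN conjunct1] that by (rule bspec)
    show "a \<le> Suc (\<sigma> n) \<and> Suc (\<sigma> n) - a \<in> L n" if "a \<in> L n" for a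
      using g3[THEN conjunct2, THEN conjunct1] that by (rule bspec)
    show "{a, b} = {a', b'}"
      if "a \<in> digits n" "b \<in> digits n" "a' \<in> digits n" "b' \<in> digits n"
        "i \<in> reach n" "j \<in> reach n" "i' \<in> reach n" "j' \<in> reach n"
        "(a + i) + (b + j) = (a' + i') + (b' + j')"
        "\<not> (a \<in> U n \<and> a + b = \<sigma> n)" "\<not> (a \<in> L n \<and> a + b = Suc (\<sigma> n))"
      for a b a' b' i j i' j'
      by (rule g3[THEN conjunct2, THEN conjunct2, rule_format, of a b a' b' i j i' j']) (intro conjI that)
  qed
  then show ?thesis by blast
qed

section \<open>Sets invariant under the diagonal action\<close>

context rank_one_system
begin

definition invariant :: "(real \<times> real) set \<Rightarrow> bool" where
  "invariant A \<longleftrightarrow> A \<in> sets borel \<and> A \<subseteq> X \<times> X \<and>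
     (\<forall>x\<in>X. \<forall>y\<in>X. (T x, T y) \<in> A \<longleftrightarrow> (x, y) \<in> A)"

lemma invariant_complement: "invariant A \<Longrightarrow> invariant (X \<times> X - A)"
  using X_borel T_in_X by (auto simp: invariant_def intro!: borel_Times sets.Diff)

definition displacement :: "nat \<Rightarrow> nat \<Rightarrow> nat \<Rightarrow> real" where
  "displacement n i j = lft n j - lft n i"

lemma displacement_mem: "x \<in> lev n i \<Longrightarrow> x + displacement n i j \<in> lev n j"
  by (simp add: lev_eq displacement_def)

lemma invariant_shift_up:
  assumes "invariant A" "x \<in> lev n i" "y \<in> lev n j" "i + m < h n" "j + m < h n"
  shows "(x + displacement n i (i + m), y + displacement n j (j + m)) \<in> A \<longleftrightarrow> (x, y) \<in> A"
  using assms(4,5)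
proof (induction m)
  case (Suc m)
  let ?x = "x + displacement n i (i + m)" and ?y = "y + displacement n j (j + m)"
  have xy: "?x \<in> lev n (i + m)" "?y \<in> lev n (j + m)"
    using assms(2,3) displacement_mem by auto
  then have "T ?x = x + displacement n i (i + Suc m)" "T ?y = y + displacement n j (j + Suc m)"
    using T_lev Suc.prems by (simp_all add: displacement_def)
  moreover have "?x \<in> X" "?y \<in> X"
    using xy Suc.prems lev_subset_X[of "i + m" n] lev_subset_X[of "j + m" n] by auto
  ultimately have "(x + displacement n i (i + Suc m), y + displacement n j (j + Suc m)) \<in> A
      \<longleftrightarrow> (?x, ?y) \<in> A"
    using assms(1) unfolding invariant_def by metis
  also have "\<dots> \<longleftrightarrow> (x, y) \<in> A" using Suc by simp
  finally show ?case .
qed (simp add: displacement_def)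

text \<open>An invariant set looks the same in any two rectangles of one stage with the same difference of
  heights, since some power of \<open>T \<times> T\<close> translates one to the other.\<close>
lemma invariant_shift:
  assumes "invariant A" "x \<in> lev n i" "y \<in> lev n j"
    and bounds: "i < h n" "j < h n" "i' < h n" "j' < h n" and "i + j' = i' + j"
  shows "(x + displacement n i i', y + displacement n j j') \<in> A \<longleftrightarrow> (x, y) \<in> A"
proof (cases "i \<le> i'")
  case True
  then have "j + (i' - i) = j'" using assms by simp
  with True invariant_shift_up[OF assms(1-3), of "i' - i"] bounds show ?thesis by simp
next
  case False
  let ?x = "x + displacement n i i'" and ?y = "y + displacement n j j'"
  have *: "i' + (i - i') = i" "j' + (i - i') = j" using False assms by auto
  have "?x + displacement n i' i = x" "?y + displacement n j' j = y"
    by (simp_all add: displacement_def)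
  with invariant_shift_up[OF assms(1), of ?x n i' ?y j' "i - i'"] * bounds
    displacement_mem[OF assms(2)] displacement_mem[OF assms(3)]
  show ?thesis by simp
qed

end

text \<open>The set \<open>U \<times> L\<close> and its image \<open>L \<times> U\<close> are disjoint quarters of all pairs, and by the last
  assumption they carry no more together than the bound allows for one of them.\<close>
lemma sum_pairs_le_three_quarters:
  fixes f :: "nat \<times> nat \<Rightarrow> real" and U L :: "nat set"
  assumes fin: "finite U" "finite L" and disj: "U \<inter> L = {}" and card: "card U = m" "card L = m"
    and bij: "bij_betw \<phi> (U \<times> L) (L \<times> U)"
    and le: "\<And>p. p \<in> (U \<union> L) \<times> (U \<union> L) \<Longrightarrow> f p \<le> q"
    and pair_le: "\<And>p. p \<in> U \<times> L \<Longrightarrow> f p + f (\<phi> p) \<le> q"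
  shows "sum f ((U \<union> L) \<times> (U \<union> L)) \<le> 3 / 4 * (real (2 * m))\<^sup>2 * q"
proof -
  have "(U \<union> L) \<times> (U \<union> L) = (U \<times> U \<union> L \<times> L) \<union> (U \<times> L \<union> L \<times> U)" by auto
  also have "sum f \<dots> = sum f (U \<times> U) + sum f (L \<times> L) + (sum f (U \<times> L) + sum f (L \<times> U))"
    using fin disj by (subst sum.union_disjoint; (subst sum.union_disjoint)?; auto)+
  also have "sum f (L \<times> U) = sum (\<lambda>p. f (\<phi> p)) (U \<times> L)"
    by (rule sum.reindex_bij_betw[OF bij, symmetric])
  also have "sum f (U \<times> L) + sum (\<lambda>p. f (\<phi> p)) (U \<times> L) = sum (\<lambda>p. f p + f (\<phi> p)) (U \<times> L)"
    by (rule sum.distrib[symmetric])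
  also have "\<dots> \<le> real (card (U \<times> L)) * q" by (rule sum_bounded_above) (rule pair_le)
  also have "sum f (U \<times> U) \<le> real (card (U \<times> U)) * q" by (rule sum_bounded_above) (auto intro: le)
  also have "sum f (L \<times> L) \<le> real (card (L \<times> L)) * q" by (rule sum_bounded_above) (auto intro: le)
  also have "real (card (U \<times> U)) * q + real (card (L \<times> L)) * q + real (card (U \<times> L)) * q
    = 3 / 4 * (real (2 * m))\<^sup>2 * q"
    by (simp add: card_cartesian_product card power2_eq_square)
  finally show ?thesis by simp
qed

section \<open>Ergodicity of the square\<close>

context paired_rank_one_system
begin

lemma r_eq: "r n = 2 * (2 * \<gamma> n)"
proof -
  have fin: "finite (U n)" "finite (L n)" using finite_digits[of n] by (auto simp: digits_eq)
  show ?thesis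
    using card_digits[of n] card_Un_disjoint[OF fin U_L_disjoint]
    by (simp add: digits_eq card_U card_L)
qed

text \<open>The exchange of digits behind the ergodicity of \<open>T \<times> T\<close>: each digit of the pair is replaced by the
  partner of the other one. For \<open>a\<close> in \<open>U n\<close> and \<open>b\<close> in \<open>L n\<close> the difference of the new digits
  is \<open>(\<sigma> n + 1 - b) - (\<sigma> n - a) = (a - b) + 1\<close>.\<close>
lemma bij_betw_partner_swap:
  "bij_betw (\<lambda>(a, b). (Suc (\<sigma> n) - b, \<sigma> n - a)) (U n \<times> L n) (L n \<times> U n)"
  by (rule bij_betw_byWitness[where f'="\<lambda>(a, b). (\<sigma> n - b, Suc (\<sigma> n) - a)"])
     (use U_partner L_partner in auto)

text \<open>Let \<open>B\<close> be the set of points of \<open>A\<close> that leave \<open>A\<close> under \<open>1 \<times> T\<close>. In a rectangle \<open>R\<close>, take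
  the subrectangle \<open>Q\<close> with digits \<open>(a, b)\<close> in \<open>U \<times> L\<close> and the subrectangle \<open>Q'\<close> with the exchanged
  digits. As the exchange raises the difference of the heights by one, a power of \<open>T \<times> T\<close> moves
  \<open>Q\<close> onto the image of \<open>Q'\<close> under \<open>1 \<times> T\<close>. A point of \<open>B\<close> in \<open>Q\<close> is in \<open>A\<close>, hence so is its
  image; the corresponding point of \<open>Q'\<close> therefore does not leave \<open>A\<close>. So the parts of \<open>B\<close> in
  \<open>Q\<close> and \<open>Q'\<close> together have at most the measure of \<open>Q\<close>, and \<open>B\<close> fills at most three
  quarters of \<open>R\<close>.\<close>
lemma measure_leaving_le:
  assumes inv: "invariant A" and j: "Suc j0 < h n" and n: "n \<le> N" and ij: "i < h N" "j < h N"
    and B: "B = {p \<in> A. snd p \<in> lev n j0 \<and> (fst p, snd p + displacement n j0 (Suc j0)) \<notin> A}"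
    and B_borel: "B \<in> sets borel"
  shows "measure lborel (B \<inter> rect N i j) \<le> 3 / 4 * (w N)\<^sup>2"
proof (cases "B \<inter> rect N i j = {}")
  case True
  then show ?thesis using w_pos[of N] by simp
next
  case False
  then obtain p where p: "p \<in> B" "p \<in> rect N i j" by auto
  then have "snd p \<in> lev n j0" "snd p \<in> lev N j" by (auto simp: B rect_iff)
  from descend[OF this(1) Suc_lessD[OF j] n] obtain j' where
    j': "j' < h N" "snd p \<in> lev N j'" "lev N j' \<subseteq> lev n j0"
    "Suc j' < h N" "lft N (Suc j') - lft N j' = lft n (Suc j0) - lft n j0" using j by metis
  moreover have "j' = j" using j'(2) \<open>snd p \<in> lev N j\<close> j'(1) ij(2) by (rule lev_unique)
  ultimately have Suc_j: "Suc j < h N"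
    and disp: "displacement n j0 (Suc j0) = displacement N j (Suc j)"
    by (auto simp: displacement_def)
  let ?Q = "\<lambda>(a, b). rect (Suc N) (a + i) (b + j)"
  let ?f = "\<lambda>p. measure lborel (B \<inter> ?Q p)"
  let ?\<phi> = "\<lambda>(a, b). (Suc (\<sigma> N) - b, \<sigma> N - a)"
  have f_le: "?f p \<le> (w (Suc N))\<^sup>2" for p
  proof (cases p)
    case (Pair a b)
    have "measure lborel (B \<inter> rect (Suc N) (a + i) (b + j)) \<le> measure lborel (rect (Suc N) (a + i) (b + j))"
      using B_borel by (intro measure_mono_fmeasurable rect_fmeasurable) auto
    then show ?thesis by (simp add: Pair measure_rect)
  qed
  have pair_le: "?f p + ?f (?\<phi> p) \<le> (w (Suc N))\<^sup>2" if pUL: "p \<in> U N \<times> L N" for p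
  proof -
    obtain a b where p: "p = (a, b)" and a: "a \<in> U N" and b: "b \<in> L N" using pUL by auto
    define a' where "a' = Suc (\<sigma> N) - b"
    define b' where "b' = \<sigma> N - a"
    have a': "a' \<in> L N" "a' + b = Suc (\<sigma> N)" using L_partner[OF b] by (auto simp: a'_def)
    have b': "b' \<in> U N" "a + b' = \<sigma> N" using U_partner[OF a] by (auto simp: b'_def)
    have dig: "a \<in> digits N" "b \<in> digits N" "a' \<in> digits N" "b' \<in> digits N"
      using a b a' b' by (auto simp: digits_eq)
    \<comment> \<open>The translation of \<open>Q\<close> onto \<open>Q'\<close>: one step of \<open>1 \<times> T\<close> short of a power of \<open>T \<times> T\<close>.\<close>
    define c where "c = (displacement (Suc N) (a + i) (a' + i), displacement (Suc N) (b + j) (b' + j))"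
    have moved: "c + p \<in> rect (Suc N) (a' + i) (b' + j) - B"
      if "p \<in> B \<inter> rect (Suc N) (a + i) (b + j)" for p
    proof -
      obtain x y where xy: "p = (x, y)" by (cases p)
      have x: "x \<in> lev (Suc N) (a + i)" and y: "y \<in> lev (Suc N) (b + j)" and A: "(x, y) \<in> A"
        using that by (auto simp: xy rect_iff B)
      have cp: "c + p = (x + displacement (Suc N) (a + i) (a' + i), y + displacement (Suc N) (b + j) (b' + j))"
        by (simp add: c_def xy)
      have rect: "c + p \<in> rect (Suc N) (a' + i) (b' + j)"
        unfolding cp using x y displacement_mem by (auto simp: rect_iff)
      have "(x + displacement (Suc N) (a + i) (a' + i),
             y + displacement (Suc N) (b + j) (b' + Suc j)) \<in> A \<longleftrightarrow> (x, y) \<in> A"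
        using dig ij Suc_j a' b' by (intro invariant_shift[OF inv x y] digit_add_less) auto
      moreover have "displacement (Suc N) (b + j) (b' + Suc j)
          = displacement (Suc N) (b + j) (b' + j) + displacement n j0 (Suc j0)"
        unfolding disp using lft_digit_add_diff[OF dig(4) Suc_j ij(2)] by (simp add: displacement_def)
      ultimately have "(fst (c + p), snd (c + p) + displacement n j0 (Suc j0)) \<in> A"
        using A by (simp add: cp add.assoc)
      with rect show ?thesis by (simp add: B)
    qed
    have "?f p \<le> measure lborel (rect (Suc N) (a' + i) (b' + j) - B)"
      unfolding p using moved B_borel rect_fmeasurable
      by (auto intro!: measure_le_of_translate_into[of _ _ c] fmeasurable_Diff)
    moreover have "measure lborel (rect (Suc N) (a' + i) (b' + j))
        = measure lborel (B \<inter> rect (Suc N) (a' + i) (b' + j)) + measure lborel (rect (Suc N) (a' + i) (b' + j) - B)"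
    proof -
      have *: "rect (Suc N) (a' + i) (b' + j) =
        (B \<inter> rect (Suc N) (a' + i) (b' + j)) \<union> (rect (Suc N) (a' + i) (b' + j) - B)" by auto
      show ?thesis
        using inter_rect_fmeasurable[OF B_borel, of "Suc N" "a' + i" "b' + j"]
          fmeasurable_Diff[OF rect_fmeasurable, of B "Suc N" "a' + i" "b' + j"] B_borel
        by (subst (1) *, intro measure_Union) (auto simp: fmeasurable_def less_top)
    qed
    ultimately show ?thesis by (simp add: p measure_rect a'_def b'_def)
  qed
  have "measure lborel (B \<inter> rect N i j) = sum ?f (digits N \<times> digits N)"
    using measure_inter_rect_split[OF B_borel ij] by (simp add: case_prod_unfold)
  also have "\<dots> \<le> 3 / 4 * (real (2 * (2 * \<gamma> N)))\<^sup>2 * (w (Suc N))\<^sup>2"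
    unfolding digits_eq
    by (rule sum_pairs_le_three_quarters[where \<phi>="?\<phi>"])
       (use finite_digits[of N] U_L_disjoint card_U card_L bij_betw_partner_swap f_le pair_le
         in \<open>auto simp: digits_eq\<close>)
  also have "\<dots> = 3 / 4 * (w N)\<^sup>2"
    unfolding r_eq[symmetric] using r_pos[of N] by (simp add: w_Suc power_divide)
  finally show ?thesis .
qed

text \<open>By the density bound almost no point leaves an invariant set under \<open>1 \<times> T\<close>, so
  translation to the next level loses no measure. The reverse inequality is this one for the
  complement.\<close>
lemma measure_inter_rect_Suc_ge:
  assumes inv: "invariant A" and ij: "i < h n" "Suc j < h n"
  shows "measure lborel (A \<inter> rect n i j) \<le> measure lborel (A \<inter> rect n i (Suc j))"
proof -
  have A: "A \<in> sets borel" "A \<subseteq> X \<times> X" using inv by (auto simp: invariant_def)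
  define B where "B = {p \<in> A. snd p \<in> lev n j \<and> (fst p, snd p + displacement n j (Suc j)) \<notin> A}"
  have "B = A \<inter> (UNIV \<times> lev n j) - (\<lambda>p. (fst p, snd p + displacement n j (Suc j))) -` A"
    by (auto simp: B_def)
  moreover have "(\<lambda>p. (fst p, snd p + displacement n j (Suc j))) -` A \<in> sets (borel :: (real \<times> real) measure)"
    using A(1) by (intro measurable_sets_borel[of _ borel]) (auto intro!: borel_measurable_continuous_onI continuous_intros)
  ultimately have B_borel: "B \<in> sets borel"
    using A(1) lev_borel by (auto intro!: borel_Times sets.Diff sets.Int)
  have "B \<in> null_sets lborel"
    using A(2) by (intro null_if_density_bounded[where c="3/4" and n=n] B_borel
        measure_leaving_le[OF inv ij(2) _ _ _ B_def B_borel]) (auto simp: B_def)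
  then have "measure lborel (A \<inter> rect n i j) = measure lborel (A \<inter> rect n i j - B)"
    using A(1) by (intro measure_Diff_null_set[symmetric]) auto
  also have "\<dots> \<le> measure lborel (A \<inter> rect n i (Suc j))"
    using A(1) B_borel inter_rect_fmeasurable[OF A(1)] displacement_mem
    by (intro measure_le_of_translate_into[of _ _ "(0, displacement n j (Suc j))"])
       (auto simp: B_def rect_iff add.commute)
  finally show ?thesis .
qed

lemma measure_inter_rect_Suc_eq:
  assumes inv: "invariant A" and ij: "i < h n" "Suc j < h n"
  shows "measure lborel (A \<inter> rect n i (Suc j)) = measure lborel (A \<inter> rect n i j)"
  using measure_inter_rect_Suc_ge[OF inv ij] measure_inter_rect_Suc_ge[OF invariant_complement[OF inv] ij]
    measure_rect_minus[of A i n j] measure_rect_minus[of A i n "Suc j"] inv ij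
  by (simp add: invariant_def)

lemma measure_inter_rect_diagonal:
  assumes inv: "invariant A" and ij: "Suc i < h n" "Suc j < h n"
  shows "measure lborel (A \<inter> rect n i j) \<le> measure lborel (A \<inter> rect n (Suc i) (Suc j))"
proof (rule measure_le_of_translate_into[where c="(displacement n i (Suc i), displacement n j (Suc j))"])
  have A: "A \<in> sets borel" using inv by (simp add: invariant_def)
  then show "A \<inter> rect n i j \<in> sets borel" "A \<inter> rect n (Suc i) (Suc j) \<in> fmeasurable lborel"
    using inter_rect_fmeasurable by auto
  fix p assume p: "p \<in> A \<inter> rect n i j"
  obtain x y where xy: "p = (x, y)" by (cases p)
  then have "(x, y) \<in> A" "x \<in> lev n i" "y \<in> lev n j" using p by (auto simp: rect_iff)
  then show "(displacement n i (Suc i), displacement n j (Suc j)) + p \<in> A \<inter> rect n (Suc i) (Suc j)"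
    using invariant_shift[OF inv, of x n i y j "Suc i" "Suc j"] displacement_mem ij
    by (auto simp: rect_iff xy add.commute)
qed

text \<open>Vertical steps together with diagonal steps connect all rectangles of one stage.\<close>
lemma measure_inter_rect_const:
  assumes inv: "invariant A" and ij: "i < h n" "j < h n"
  shows "measure lborel (A \<inter> rect n i j) = measure lborel (A \<inter> rect n 0 0)"
proof -
  have row: "measure lborel (A \<inter> rect n i j) = measure lborel (A \<inter> rect n i 0)" if "i < h n" "j < h n" for i j
    using that(2) by (induction j) (simp_all add: measure_inter_rect_Suc_eq[OF inv that(1)])
  have "measure lborel (A \<inter> rect n i 0) = measure lborel (A \<inter> rect n 0 0)" using ij(1)
  proof (induction i)
    case (Suc i)
    have le: "measure lborel (A' \<inter> rect n i 0) \<le> measure lborel (A' \<inter> rect n (Suc i) (Suc 0))"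
      if "invariant A'" for A'
      using measure_inter_rect_diagonal[OF that, of i n 0] Suc.prems by simp
    have "measure lborel (A \<inter> rect n i 0) = measure lborel (A \<inter> rect n (Suc i) (Suc 0))"
      using le[OF inv] le[OF invariant_complement[OF inv]] Suc.prems inv
        measure_rect_minus[of A i n 0] measure_rect_minus[of A "Suc i" n "Suc 0"]
      by (simp add: invariant_def)
    then show ?case using Suc row[of "Suc i" "Suc 0"] by simp
  qed simp
  with row[OF ij] show ?thesis by simp
qed

text \<open>The relative measure of an invariant set is the same in all rectangles of a stage, and hence also
  the same at all stages, because a rectangle is a union of rectangles of the next stage.\<close>
lemma measure_inter_rect_eq:
  assumes inv: "invariant A" and ij: "i < h n" "j < h n"
  shows "measure lborel (A \<inter> rect n i j) = measure lborel (A \<inter> rect 0 0 0) * (w n)\<^sup>2"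
proof -
  have A: "A \<in> sets borel" using inv by (simp add: invariant_def)
  have "measure lborel (A \<inter> rect n 0 0) = measure lborel (A \<inter> rect 0 0 0) * (w n)\<^sup>2"
  proof (induction n)
    case (Suc n)
    have "measure lborel (A \<inter> rect n 0 0)
        = (\<Sum>(a,b)\<in>digits n \<times> digits n. measure lborel (A \<inter> rect (Suc n) (a + 0) (b + 0)))"
      by (rule measure_inter_rect_split[OF A h_pos h_pos])
    also have "\<dots> = (\<Sum>(a,b)\<in>digits n \<times> digits n. measure lborel (A \<inter> rect (Suc n) 0 0))"
    proof (intro sum.cong refl, clarify)
      fix a b assume "a \<in> digits n" "b \<in> digits n"
      then show "measure lborel (A \<inter> rect (Suc n) (a + 0) (b + 0)) = measure lborel (A \<inter> rect (Suc n) 0 0)"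
        by (intro measure_inter_rect_const[OF inv] digit_add_less h_pos)
    qed
    also have "\<dots> = (real (r n))\<^sup>2 * measure lborel (A \<inter> rect (Suc n) 0 0)"
      by (simp add: case_prod_unfold card_cartesian_product card_digits power2_eq_square)
    finally show ?case using Suc r_pos[of n] by (simp add: w_Suc field_simps)
  qed (simp add: w_0)
  with measure_inter_rect_const[OF inv ij] show ?thesis by simp
qed

theorem invariant_null_or_conull:
  assumes inv: "invariant A"
  shows "A \<in> null_sets lborel \<or> X \<times> X - A \<in> null_sets lborel"
proof -
  define \<alpha> where "\<alpha> = measure lborel (A \<inter> rect 0 0 0)"
  have A: "A \<in> sets borel" "A \<subseteq> X \<times> X" using inv by (auto simp: invariant_def)
  have "\<alpha> \<le> measure lborel (rect 0 0 0)"
    unfolding \<alpha>_def using A by (intro measure_mono_fmeasurable rect_fmeasurable) auto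
  then have "\<alpha> \<le> 1" by (simp add: measure_rect w_0)
  show ?thesis
  proof (cases "\<alpha> < 1")
    case True
    then have "A \<in> null_sets lborel"
      using A by (intro null_if_density_bounded[where c=\<alpha> and n=0])
        (auto simp: measure_inter_rect_eq[OF inv] \<alpha>_def)
    then show ?thesis ..
  next
    case False
    with \<open>\<alpha> \<le> 1\<close> have "\<alpha> = 1" by simp
    then have "X \<times> X - A \<in> null_sets lborel"
      using A invariant_complement[OF inv]
      by (intro null_if_density_bounded[where c=0 and n=0])
        (auto simp: measure_rect_minus measure_inter_rect_eq[OF inv] \<alpha>_def invariant_def)
    then show ?thesis ..
  qed
qed

end

section \<open>Pairs of points whose digits are never partnered\<close>

context paired_rank_one_system
begin

definition partnered :: "nat \<Rightarrow> nat \<Rightarrow> nat \<Rightarrow> bool" where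
  "partnered n a b \<longleftrightarrow> a \<in> U n \<and> a + b = \<sigma> n \<or> a \<in> L n \<and> a + b = Suc (\<sigma> n)"

lemma partnered_commute: "partnered n a b \<Longrightarrow> partnered n b a"
  unfolding partnered_def using U_partner[of a n] L_partner[of a n]
  by (metis add.commute add_diff_cancel_left')

text \<open>The pairs of heights in column \<open>n\<close> of those pairs of points of the unit interval that have no
  partnered digits before stage \<open>n\<close>.\<close>
primrec unpartnered :: "nat \<Rightarrow> (nat \<times> nat) set" where
  "unpartnered 0 = {(0, 0)}"
| "unpartnered (Suc n) = (\<lambda>((i, j), (a, b)). (a + i, b + j)) `
     (unpartnered n \<times> (digits n \<times> digits n - {(a, b). partnered n a b}))"

lemma unpartnered_SucE:
  assumes "(i, j) \<in> unpartnered (Suc n)"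
  obtains a b i0 j0 where "i = a + i0" "j = b + j0" "a \<in> digits n" "b \<in> digits n"
    "\<not> partnered n a b" "(i0, j0) \<in> unpartnered n"
  using assms by auto

lemma unpartnered_SucI:
  assumes "a \<in> digits n" "b \<in> digits n" "\<not> partnered n a b" "(i, j) \<in> unpartnered n"
  shows "(a + i, b + j) \<in> unpartnered (Suc n)"
proof -
  have "((i, j), (a, b)) \<in> unpartnered n \<times> (digits n \<times> digits n - {(a, b). partnered n a b})"
    using assms by simp
  from imageI[OF this, of "\<lambda>((i, j), (a, b)). (a + i, b + j)"] show ?thesis by simp
qed

lemma unpartnered_reach: "(i, j) \<in> unpartnered n \<Longrightarrow> i \<in> reach n \<and> j \<in> reach n"
proof (induction n arbitrary: i j)
  case (Suc n)
  from Suc.prems show ?case by (elim unpartnered_SucE) (use Suc.IH in auto)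
qed simp

lemma unpartnered_less: "(i, j) \<in> unpartnered n \<Longrightarrow> i < h n \<and> j < h n"
  using unpartnered_reach reach_less by blast

text \<open>The sum of two reachable heights decides whether their digits are unpartnered at every stage. By
  rigidity the last digits agree up to order, so the sums of the remaining heights agree as well, and
  the argument descends.\<close>
lemma unpartnered_determined_by_sum:
  assumes "(i, j) \<in> unpartnered n" "i' \<in> reach n" "j' \<in> reach n" "i + j = i' + j'"
  shows "(i', j') \<in> unpartnered n"
  using assms
proof (induction n arbitrary: i j i' j')
  case (Suc n)
  obtain a b i0 j0 where ij: "i = a + i0" "j = b + j0" and ab: "a \<in> digits n" "b \<in> digits n"
    "\<not> partnered n a b" and good: "(i0, j0) \<in> unpartnered n"
    using Suc.prems(1) by (rule unpartnered_SucE)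
  obtain a' i0' where i': "i' = a' + i0'" "a' \<in> digits n" "i0' \<in> reach n" using Suc.prems(2) by auto
  obtain b' j0' where j': "j' = b' + j0'" "b' \<in> digits n" "j0' \<in> reach n" using Suc.prems(3) by auto
  have "{a, b} = {a', b'}"
    using rigid[of a n b a' b' i0 j0 i0' j0'] ab i' j' unpartnered_reach[OF good] Suc.prems(4) ij
    by (simp add: partnered_def)
  then have cases: "a = a' \<and> b = b' \<or> a = b' \<and> b = a'" by (simp add: doubleton_eq_iff)
  then have "i0 + j0 = i0' + j0'" using Suc.prems(4) ij i' j' by auto
  then have "(i0', j0') \<in> unpartnered n" using Suc.IH[OF good] i' j' by blast
  moreover have "\<not> partnered n a' b'" using cases ab(3) partnered_commute by blast
  ultimately show ?case using unpartnered_SucI i' j' by simp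
qed simp

definition unpartnered_region :: "nat \<Rightarrow> (real \<times> real) set" where
  "unpartnered_region n = (\<Union>(i, j)\<in>unpartnered n. rect n i j)"

lemma finite_unpartnered: "finite (unpartnered n)"
  by (rule finite_subset[of _ "{..<h n} \<times> {..<h n}"]) (use unpartnered_less in auto)

lemma unpartnered_region_borel: "unpartnered_region n \<in> sets borel"
  unfolding unpartnered_region_def by (intro sets.finite_UN finite_unpartnered) auto

lemma measure_unpartnered_region:
  "measure lborel (unpartnered_region n) = real (card (unpartnered n)) * (w n)\<^sup>2"
proof -
  have "measure lborel (UNIV \<inter> unpartnered_region n)
      = (\<Sum>(i, j)\<in>unpartnered n. measure lborel (UNIV \<inter> rect n i j))"
    unfolding unpartnered_region_def
    by (rule measure_inter_rects) (use finite_unpartnered unpartnered_less in auto)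
  then show ?thesis by (simp add: measure_rect case_prod_unfold)
qed

lemma unpartnered_region_fmeasurable: "unpartnered_region n \<in> fmeasurable lborel"
  unfolding unpartnered_region_def
  by (intro fmeasurable.finite_UN finite_unpartnered) (auto simp: rect_fmeasurable)

lemma unpartnered_region_Suc: "unpartnered_region (Suc n) \<subseteq> unpartnered_region n"
proof
  fix p assume "p \<in> unpartnered_region (Suc n)"
  then obtain i j where "(i, j) \<in> unpartnered (Suc n)" and p: "p \<in> rect (Suc n) i j"
    unfolding unpartnered_region_def by blast
  then obtain a b i0 j0 where *: "i = a + i0" "j = b + j0" "a \<in> digits n" "b \<in> digits n"
    "(i0, j0) \<in> unpartnered n" by (elim unpartnered_SucE)
  then have "p \<in> rect n i0 j0"
    using rect_split[of i0 n j0] unpartnered_less[of i0 j0 n] p by auto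
  with * show "p \<in> unpartnered_region n" by (auto simp: unpartnered_region_def)
qed

lemma decseq_unpartnered_region: "decseq unpartnered_region"
  by (intro decseq_SucI unpartnered_region_Suc)

lemma card_partnered_le: "card {(a, b). partnered n a b} \<le> 4 * \<gamma> n" (is "card ?P \<le> _")
  and finite_partnered: "finite {(a, b). partnered n a b}"
proof -
  have fin: "finite (U n)" "finite (L n)" using finite_digits[of n] by (auto simp: digits_eq)
  have sub: "?P \<subseteq> (\<lambda>a. (a, \<sigma> n - a)) ` U n \<union> (\<lambda>a. (a, Suc (\<sigma> n) - a)) ` L n"
    by (auto simp: partnered_def)
  then show "finite ?P" by (rule finite_subset) (use fin in auto)
  have "card ?P \<le> card ((\<lambda>a. (a, \<sigma> n - a)) ` U n \<union> (\<lambda>a. (a, Suc (\<sigma> n) - a)) ` L n)"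
    using fin sub by (intro card_mono) auto
  also have "\<dots> \<le> card ((\<lambda>a. (a, \<sigma> n - a)) ` U n) + card ((\<lambda>a. (a, Suc (\<sigma> n) - a)) ` L n)"
    by (rule card_Un_le)
  also have "\<dots> \<le> card (U n) + card (L n)" by (intro add_mono card_image_le fin)
  finally show "card ?P \<le> 4 * \<gamma> n" by (simp add: card_U card_L)
qed

lemma card_unpartnered_Suc:
  "card (unpartnered (Suc n))
    = card (unpartnered n) * card (digits n \<times> digits n - {(a, b). partnered n a b})"
proof -
  have "inj_on (\<lambda>((i, j), (a, b)). (a + i, b + j))
      (unpartnered n \<times> (digits n \<times> digits n - {(a, b). partnered n a b}))"
    unfolding inj_on_def using digit_add_unique unpartnered_less
    by (clarsimp simp del: unpartnered.simps) metis
  then show ?thesis by (simp add: card_image card_cartesian_product)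
qed

text \<open>At most \<open>4 * \<gamma> n\<close> of the \<open>(4 * \<gamma> n)\<^sup>2\<close> pairs of digits are partnered, which is the
  proportion \<open>1 / (4 * \<gamma> n)\<close>.\<close>
lemma measure_unpartnered_region_Suc_ge:
  "measure lborel (unpartnered_region n) * (1 - 1 / (4 * real (\<gamma> n)))
    \<le> measure lborel (unpartnered_region (Suc n))"
proof -
  let ?P = "{(a, b). partnered n a b}" and ?D = "digits n \<times> digits n"
  have "card ?D - card ?P \<le> card (?D - ?P)" by (rule diff_card_le_card_Diff) (rule finite_partnered)
  moreover have "card ?D = r n * r n" by (simp add: card_cartesian_product card_digits)
  ultimately have "real (r n * r n) - real (4 * \<gamma> n) \<le> real (card (?D - ?P))"
    using card_partnered_le[of n] by linarith
  moreover have "real (r n * r n) - real (4 * \<gamma> n) = (1 - 1 / (4 * real (\<gamma> n))) * (real (r n))\<^sup>2"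
    using \<gamma>_pos[of n] by (simp add: r_eq power2_eq_square field_simps)
  ultimately have "(1 - 1 / (4 * real (\<gamma> n))) * (real (r n))\<^sup>2 \<le> real (card (?D - ?P))" by simp
  then have "(real (card (unpartnered n)) * (w (Suc n))\<^sup>2) * ((1 - 1 / (4 * real (\<gamma> n))) * (real (r n))\<^sup>2)
      \<le> (real (card (unpartnered n)) * (w (Suc n))\<^sup>2) * real (card (?D - ?P))"
    by (intro mult_left_mono) auto
  also have "(real (card (unpartnered n)) * (w (Suc n))\<^sup>2) * ((1 - 1 / (4 * real (\<gamma> n))) * (real (r n))\<^sup>2)
      = real (card (unpartnered n)) * (w n)\<^sup>2 * (1 - 1 / (4 * real (\<gamma> n)))"
    using r_pos[of n] by (simp add: w_Suc power_divide)
  finally show ?thesis by (simp add: measure_unpartnered_region card_unpartnered_Suc del: unpartnered.simps)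
     (simp add: mult_ac)
qed

lemma measure_unpartnered_region_ge:
  "(\<Prod>k<n. 1 - 1 / (4 * real (\<gamma> k))) \<le> measure lborel (unpartnered_region n)"
proof (induction n)
  case (Suc n)
  have "1 - 1 / (4 * real (\<gamma> n)) \<ge> 0" using \<gamma>_pos[of n] by (simp add: field_simps)
  then have "(\<Prod>k<Suc n. 1 - 1 / (4 * real (\<gamma> k)))
      \<le> measure lborel (unpartnered_region n) * (1 - 1 / (4 * real (\<gamma> n)))"
    using Suc by (simp add: mult_right_mono)
  also have "\<dots> \<le> measure lborel (unpartnered_region (Suc n))" by (rule measure_unpartnered_region_Suc_ge)
  finally show ?case .
qed (simp add: measure_unpartnered_region w_0)

lemma measure_Inter_unpartnered_region_ge:
  assumes "\<And>n. p \<le> (\<Prod>k<n. 1 - 1 / (4 * real (\<gamma> k)))"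
  shows "p \<le> measure lborel (\<Inter>n. unpartnered_region n)"
proof (rule LIMSEQ_le_const)
  show "(\<lambda>n. measure lborel (unpartnered_region n)) \<longlonglongrightarrow> measure lborel (\<Inter>n. unpartnered_region n)"
    using unpartnered_region_fmeasurable
    by (intro Lim_measure_decseq decseq_unpartnered_region) (auto simp: fmeasurable_def less_top)
qed (use assms measure_unpartnered_region_ge order_trans in blast)

text \<open>The pairs of points whose sum of heights in column \<open>n\<close> is one that occurs for unpartnered digits.
  As \<open>T \<times> T\<inverse>\<close> preserves the sum of the heights in all late columns, membership for all late \<open>n\<close> is
  an invariant property; in the unit square it singles out the unpartnered pairs.\<close>
definition sum_region :: "nat \<Rightarrow> (real \<times> real) set" where
  "sum_region n = (\<Union>(i, j)\<in>{(i, j). i < h n \<and> j < h n \<and> (\<exists>(i', j')\<in>unpartnered n. i + j = i' + j')}. rect n i j)"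

lemma sum_region_iff:
  assumes "p \<in> rect n i j" "i < h n" "j < h n"
  shows "p \<in> sum_region n \<longleftrightarrow> (\<exists>(i', j')\<in>unpartnered n. i + j = i' + j')"
proof
  assume "p \<in> sum_region n"
  then obtain i1 j1 where *: "i1 < h n" "j1 < h n" "p \<in> rect n i1 j1"
    "\<exists>(i', j')\<in>unpartnered n. i1 + j1 = i' + j'" unfolding sum_region_def by blast
  then show "\<exists>(i', j')\<in>unpartnered n. i + j = i' + j'"
    using rect_unique[OF *(3) assms(1)] assms(2,3) by simp
next
  assume "\<exists>(i', j')\<in>unpartnered n. i + j = i' + j'"
  then show "p \<in> sum_region n" unfolding sum_region_def using assms by blast
qed

lemma sum_region_borel: "sum_region n \<in> sets borel"
proof -
  let ?I = "{(i, j). i < h n \<and> j < h n \<and> (\<exists>(i', j')\<in>unpartnered n. i + j = i' + j')}"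
  have "?I \<subseteq> {..<h n} \<times> {..<h n}" by blast
  then have "finite ?I" by (rule finite_subset) simp
  then show ?thesis unfolding sum_region_def
    by (rule sets.finite_UN) (simp add: case_prod_unfold rect_borel)
qed

lemma unpartnered_region_subset_sum_region: "unpartnered_region n \<subseteq> sum_region n"
  unfolding unpartnered_region_def sum_region_def using unpartnered_less by fast

lemma level_in_unit_reach:
  assumes "x \<in> lev 0 0" "x \<in> lev n i" "i < h n"
  shows "i \<in> reach n"
proof -
  have "\<exists>j\<in>reach n. x \<in> lev n j"
  proof (induction n)
    case (Suc n)
    then obtain j where j: "j \<in> reach n" "x \<in> lev n j" by auto
    with lev_split[OF reach_less[OF j(1)]] show ?case by auto
  qed (use assms in simp)
  then show ?thesis using lev_unique[OF assms(2)] assms(3) reach_less by blast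
qed

lemma sum_region_in_unit_square:
  assumes "p \<in> rect 0 0 0" "p \<in> sum_region n"
  shows "p \<in> unpartnered_region n"
proof -
  obtain i j where *: "i < h n" "j < h n" "p \<in> rect n i j"
    "\<exists>(i', j')\<in>unpartnered n. i + j = i' + j'" using assms(2) unfolding sum_region_def by blast
  then have "i \<in> reach n" "j \<in> reach n"
    using level_in_unit_reach assms(1) by (auto simp: rect_iff)
  then have "(i, j) \<in> unpartnered n" using *(4) unpartnered_determined_by_sum by fastforce
  with *(3) show ?thesis by (auto simp: unpartnered_region_def)
qed

section \<open>An invariant set for the product with the inverse\<close>

definition T_inv :: "real \<Rightarrow> real" where "T_inv = rank_one_inv r S"

definition orbit_0 :: "real set" where "orbit_0 = range (\<lambda>n. (T ^^ n) 0)"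

lemma zero_in_X: "0 \<in> X"
  unfolding X_iff by (intro exI[of _ 0]) (simp add: h_0 lev_eq lft_0_0 w_0)

lemma orbit_0_subset_X: "orbit_0 \<subseteq> X"
proof -
  have "(T ^^ n) 0 \<in> X" for n by (induction n) (auto simp: zero_in_X T_in_X)
  then show ?thesis by (auto simp: orbit_0_def)
qed

lemma T_T_inv:
  assumes "y \<in> X" "y \<noteq> 0"
  shows "T_inv y \<in> X" "T (T_inv y) = y"
proof -
  obtain n i where ni: "Suc i < h n" "y \<in> lev n (Suc i)" using assms by (rule ex_positive_level)
  define z where "z = y - lft n (Suc i) + lft n i"
  have z: "z \<in> lev n i" using ni by (simp add: z_def lev_eq)
  then have "z \<in> X" using lev_subset_X[of i n] ni by auto
  moreover have "T z = y" using T_lev[OF z ni(1)] by (simp add: z_def)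
  ultimately have "y \<in> T ` X" by blast
  then have "T_inv y = inv_into X T y" by (simp add: T_inv_def rank_one_inv_def T_def X_def)
  with \<open>y \<in> T ` X\<close> show "T_inv y \<in> X" "T (T_inv y) = y"
    by (simp_all add: inv_into_into f_inv_into_f)
qed

lemma T_inv_0: "T_inv 0 = 0"
proof -
  have "T x \<noteq> 0" if x: "x \<in> X" for x
  proof
    assume "T x = 0"
    obtain n i where ni: "Suc i < h n" "x \<in> lev n i" using x by (rule ex_nontop_level)
    then have "0 \<in> lev n (Suc i)" using T_lev_Suc \<open>T x = 0\<close> by metis
    moreover have "0 \<in> lev n 0" using w_pos by (simp add: lev_eq lft_bottom)
    ultimately show False using lev_unique ni(1) h_pos by blast
  qed
  then have "0 \<notin> T ` X" by force
  then show ?thesis by (simp add: T_inv_def rank_one_inv_def T_def X_def)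
qed

lemma T_inv_orbit_0_iff:
  assumes "y \<in> X"
  shows "T_inv y \<in> orbit_0 \<longleftrightarrow> y \<in> orbit_0"
proof (cases "y = 0")
  case False
  note y = T_T_inv[OF assms False]
  show ?thesis
  proof
    assume "T_inv y \<in> orbit_0"
    then obtain n where "T_inv y = (T ^^ n) 0" by (auto simp: orbit_0_def)
    with y(2) have "y = (T ^^ Suc n) 0" by simp
    then show "y \<in> orbit_0" unfolding orbit_0_def by blast
  next
    assume "y \<in> orbit_0"
    then obtain n where n: "y = (T ^^ n) 0" by (auto simp: orbit_0_def)
    with False obtain m where m: "n = Suc m" by (cases n) auto
    have "(T ^^ m) 0 \<in> orbit_0" unfolding orbit_0_def by blast
    moreover have "T_inv y = (T ^^ m) 0"
    proof (rule inj_onD[OF inj_on_T _ y(1)])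
      show "T (T_inv y) = T ((T ^^ m) 0)" using y(2) n m by simp
      show "(T ^^ m) 0 \<in> X" using \<open>(T ^^ m) 0 \<in> orbit_0\<close> orbit_0_subset_X by blast
    qed
    ultimately show "T_inv y \<in> orbit_0" by simp
  qed
qed (simp add: T_inv_0)

lemma orbit_0_null: "orbit_0 \<in> null_sets lborel"
  unfolding orbit_0_def by (rule countable_imp_null_set_lborel) auto

text \<open>The inverse is extended to the point \<open>0\<close>, which has no preimage, by fixing it. Without the
  countable forward orbit of \<open>0\<close> the set is invariant exactly and not only almost everywhere.\<close>
definition rigid_set :: "(real \<times> real) set" where
  "rigid_set = {p \<in> X \<times> (X - orbit_0). \<forall>\<^sub>F n in sequentially. p \<in> sum_region n}"

lemma rigid_set_borel: "rigid_set \<in> sets borel"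
proof -
  have "rigid_set = (X \<times> (X - orbit_0)) \<inter> (\<Union>m. \<Inter>n\<in>{m..}. sum_region n)"
    by (auto simp: rigid_set_def eventually_sequentially)
  moreover have "orbit_0 \<in> sets borel" using orbit_0_null by auto
  ultimately show ?thesis using X_borel sum_region_borel by (auto intro!: borel_Times)
qed

lemma eventually_level_step:
  assumes "x \<in> X"
  shows "\<forall>\<^sub>F n in sequentially. \<exists>i. Suc i < h n \<and> x \<in> lev n i \<and> T x \<in> lev n (Suc i)"
proof -
  obtain m i where mi: "Suc i < h m" "x \<in> lev m i" using assms by (rule ex_nontop_level)
  show ?thesis
  proof (rule eventually_sequentiallyI)
    fix n assume "m \<le> n"
    from descend[OF mi(2) Suc_lessD[OF mi(1)] this] mi(1)
    obtain j where "Suc j < h n" "x \<in> lev n j" by metis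
    then show "\<exists>i. Suc i < h n \<and> x \<in> lev n i \<and> T x \<in> lev n (Suc i)" using T_lev_Suc by blast
  qed
qed

text \<open>In every late column \<open>T\<close> raises the first height by one and the inverse lowers the second height
  by one.\<close>
lemma rigid_set_invariant:
  assumes "x \<in> X" "y \<in> X"
  shows "(T x, T_inv y) \<in> rigid_set \<longleftrightarrow> (x, y) \<in> rigid_set"
proof (cases "y \<in> orbit_0")
  case True
  then show ?thesis using T_inv_orbit_0_iff[OF assms(2)] by (simp add: rigid_set_def)
next
  case False
  have "0 \<in> orbit_0" unfolding orbit_0_def by (rule range_eqI[of _ _ 0]) simp
  then have "y \<noteq> 0" using False by auto
  note y = T_T_inv[OF assms(2) this]
  have "\<forall>\<^sub>F n in sequentially. (T x, T_inv y) \<in> sum_region n \<longleftrightarrow> (x, y) \<in> sum_region n"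
    using eventually_level_step[OF assms(1)] eventually_level_step[OF y(1)]
  proof eventually_elim
    case (elim n)
    then obtain i j where i: "Suc i < h n" "x \<in> lev n i" "T x \<in> lev n (Suc i)"
      and j: "Suc j < h n" "T_inv y \<in> lev n j" "y \<in> lev n (Suc j)" using y(2) by auto
    have "(T x, T_inv y) \<in> sum_region n \<longleftrightarrow> (\<exists>(i', j')\<in>unpartnered n. Suc i + j = i' + j')"
      using i j by (intro sum_region_iff) (auto simp: rect_iff)
    moreover have "(x, y) \<in> sum_region n \<longleftrightarrow> (\<exists>(i', j')\<in>unpartnered n. i + Suc j = i' + j')"
      using i j by (intro sum_region_iff) (auto simp: rect_iff)
    ultimately show ?case by simp
  qed
  then have "(\<forall>\<^sub>F n in sequentially. (T x, T_inv y) \<in> sum_region n)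
      \<longleftrightarrow> (\<forall>\<^sub>F n in sequentially. (x, y) \<in> sum_region n)"
    by (rule eventually_cong) simp
  then show ?thesis
    using assms y(1) T_in_X T_inv_orbit_0_iff[OF assms(2)] by (simp add: rigid_set_def)
qed

text \<open>The set contains, up to a null set, all pairs of points of the unit interval without partnered
  digits at any stage; by independence of the stages these have at least the measure of the infinite
  product.\<close>
lemma rigid_set_not_null:
  assumes "0 < p" "\<And>n. p \<le> (\<Prod>k<n. 1 - 1 / (4 * real (\<gamma> k)))"
  shows "rigid_set \<notin> null_sets lborel"
proof
  assume null: "rigid_set \<in> null_sets lborel"
  let ?R = "\<Inter>n. unpartnered_region n"
  have "unpartnered_region 0 \<subseteq> X \<times> X"
    using lev_subset_X[of 0 0] h_0 by (auto simp: unpartnered_region_def rect_def)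
  have cover: "?R \<subseteq> rigid_set \<union> UNIV \<times> orbit_0"
  proof
    fix p assume p: "p \<in> ?R"
    then have "p \<in> sum_region n" for n using unpartnered_region_subset_sum_region by blast
    moreover have "p \<in> X \<times> X" using p \<open>unpartnered_region 0 \<subseteq> X \<times> X\<close> by blast
    ultimately show "p \<in> rigid_set \<union> UNIV \<times> orbit_0" by (cases p) (simp add: rigid_set_def)
  qed
  have "UNIV \<times> orbit_0 \<in> null_sets (lborel :: (real \<times> real) measure)"
  proof -
    have "emeasure (lborel \<Otimes>\<^sub>M lborel) ((UNIV :: real set) \<times> orbit_0) = emeasure lborel (UNIV :: real set) * emeasure lborel orbit_0"
      using orbit_0_null by (intro lborel.emeasure_pair_measure_Times) auto
    then have "emeasure (lborel \<Otimes>\<^sub>M lborel) ((UNIV :: real set) \<times> orbit_0) = 0"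
      using orbit_0_null by (simp add: null_setsD1)
    moreover have "(UNIV :: real set) \<times> orbit_0 \<in> sets borel"
      using orbit_0_null by (intro borel_Times) auto
    ultimately show ?thesis by (intro null_setsI) (simp_all add: lborel_prod)
  qed
  then have "rigid_set \<union> UNIV \<times> orbit_0 \<in> null_sets lborel" using null by (intro null_sets.Un)
  then have "?R \<in> null_sets lborel"
    by (rule null_sets_subset) (use unpartnered_region_borel cover in auto)
  then have "measure lborel ?R = 0" by (simp add: measure_eq_0_null_sets)
  then show False using measure_Inter_unpartnered_region_ge[OF assms(2)] assms(1) by simp
qed

text \<open>Pairs of points of the unit interval whose first digits are partners form a rectangle of positive
  measure outside the set.\<close>
lemma rigid_set_compl_not_null: "X \<times> X - rigid_set \<notin> null_sets lborel"
proof
  assume null: "X \<times> X - rigid_set \<in> null_sets lborel"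
  obtain a where a: "a \<in> U 0" using card_U[of 0] \<gamma>_pos[of 0] by fastforce
  define b where "b = \<sigma> 0 - a"
  have ab: "a \<in> digits 0" "b \<in> digits 0" "partnered 0 a b"
    using U_partner[OF a] a by (auto simp: digits_eq partnered_def b_def)
  have less: "a < h (Suc 0)" "b < h (Suc 0)"
    using digit_add_less[OF ab(1) h_pos] digit_add_less[OF ab(2) h_pos] by simp_all
  have sub: "rect (Suc 0) a b \<subseteq> rect 0 0 0"
    using rect_split[of 0 0 0] ab h_pos by force
  have disj: "p \<notin> rigid_set" if p: "p \<in> rect (Suc 0) a b" for p
  proof
    assume "p \<in> rigid_set"
    then obtain m where "\<forall>n\<ge>m. p \<in> sum_region n" by (auto simp: rigid_set_def eventually_sequentially)
    then have "p \<in> unpartnered_region (max 1 m)"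
      using sub p by (intro sum_region_in_unit_square) auto
    then have "p \<in> unpartnered_region (Suc 0)"
      using decseqD[OF decseq_unpartnered_region, of "Suc 0" "max 1 m"] by auto
    then obtain i j where ij: "(i, j) \<in> unpartnered (Suc 0)" "p \<in> rect (Suc 0) i j"
      unfolding unpartnered_region_def by blast
    then have "i = a \<and> j = b" using rect_unique[OF ij(2) p] unpartnered_less[OF ij(1)] less by blast
    with ij(1) ab(3) show False by auto
  qed
  have "rect (Suc 0) a b \<subseteq> X \<times> X - rigid_set"
    using disj lev_subset_X[OF less(1)] lev_subset_X[OF less(2)] by (auto simp: rect_def)
  then have "rect (Suc 0) a b \<in> null_sets lborel"
    using null_sets_subset[OF null] by simp
  then show False using w_pos[of "Suc 0"] by (auto simp: null_sets_def emeasure_rect)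
qed

end

section \<open>Ergodic square and non-ergodic product with the inverse\<close>

theorem theorem5p2:
  fixes \<gamma> \<Gamma> r :: "nat \<Rightarrow> nat" and S :: "nat \<Rightarrow> nat \<Rightarrow> real list"
  assumes "\<And>k. \<gamma> k > 0"
    and "convergent_prod (\<lambda>l. 1 - 1 / (4 * real (\<gamma> l)))"
    and "(\<Prod>l. 1 - 1 / (4 * real (\<gamma> l))) > 0"
    and "\<And>k. \<Gamma> k = \<gamma> k"
    and "rank_one r S"
    and "constructed_from \<Gamma> \<gamma> r S"
  shows "ergodic (rank_one_measure r S \<Otimes>\<^sub>M rank_one_measure r S)
           (map_prod (rank_one_map r S) (rank_one_map r S)) \<and>
         \<not> ergodic (rank_one_measure r S \<Otimes>\<^sub>M rank_one_measure r S)
           (map_prod (rank_one_map r S) (rank_one_inv r S))"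
proof -
  have "\<Gamma> = \<gamma>" using assms(4) by (rule ext)
  interpret rank_one_system r S by (rule rank_one_system.intro) (rule assms(5))
  have "constructed_from \<gamma> \<gamma> r S" using assms(6) by (simp add: \<open>\<Gamma> = \<gamma>\<close>)
  from ex_pairing[of \<gamma>, OF assms(1) this] obtain U L \<sigma>
    where "paired_rank_one_system r S \<gamma> U L \<sigma>" by blast
  then interpret paired_rank_one_system r S \<gamma> U L \<sigma> .
  let ?M = "rank_one_measure r S \<Otimes>\<^sub>M rank_one_measure r S"
  have M_def: "rank_one_measure r S = restrict_space lborel X" by (simp add: rank_one_measure_def X_def)
  have space_M: "space ?M = X \<times> X" by (simp add: M_def space_pair_measure space_restrict_space)
  have sets_M: "A \<in> sets ?M \<longleftrightarrow> A \<in> sets borel \<and> A \<subseteq> X \<times> X" for A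
    unfolding M_def by (rule sets_pair_restrict_lborel_iff[OF X_borel X_borel])
  have null_M: "A \<in> null_sets ?M \<longleftrightarrow> A \<in> null_sets lborel" if "A \<in> sets borel" "A \<subseteq> X \<times> X" for A
    using that sets_M[of A] emeasure_pair_restrict_lborel[OF X_borel X_borel that]
    by (simp add: null_sets_def M_def)
  have "ergodic ?M (map_prod T T)"
    unfolding ergodic_def
  proof (intro ballI impI)
    fix A assume "A \<in> sets ?M" and pre: "map_prod T T -` A \<inter> space ?M = A"
    then have A: "A \<in> sets borel" "A \<subseteq> X \<times> X" by (auto simp: sets_M)
    have "(T x, T y) \<in> A \<longleftrightarrow> (x, y) \<in> A" if "x \<in> X" "y \<in> X" for x y
    proof -
      have "(x, y) \<in> map_prod T T -` A \<inter> space ?M \<longleftrightarrow> (T x, T y) \<in> A"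
        using that by (simp add: space_M)
      then show ?thesis unfolding pre by simp
    qed
    with A have inv: "invariant A" by (simp add: invariant_def)
    show "A \<in> null_sets ?M \<or> space ?M - A \<in> null_sets ?M"
      using invariant_null_or_conull[OF inv] null_M[OF A] invariant_complement[OF inv]
        null_M[of "X \<times> X - A"] by (simp add: space_M invariant_def)
  qed
  moreover have "\<not> ergodic ?M (map_prod T T_inv)"
  proof
    assume erg: "ergodic ?M (map_prod T T_inv)"
    have sub: "rigid_set \<subseteq> X \<times> X" by (auto simp: rigid_set_def)
    have "map_prod T T_inv -` rigid_set \<inter> space ?M = rigid_set"
      using rigid_set_invariant sub by (auto simp: space_M)
    moreover have "rigid_set \<in> sets ?M" using sub rigid_set_borel by (simp add: sets_M)
    ultimately have "rigid_set \<in> null_sets ?M \<or> X \<times> X - rigid_set \<in> null_sets ?M"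
      using erg by (auto simp: ergodic_def space_M)
    then have "rigid_set \<in> null_sets lborel \<or> X \<times> X - rigid_set \<in> null_sets lborel"
      using null_M[OF rigid_set_borel sub] null_M[of "X \<times> X - rigid_set"] rigid_set_borel X_borel
      by (auto intro!: borel_Times)
    moreover have "rigid_set \<notin> null_sets lborel"
    proof (rule rigid_set_not_null[OF assms(3)])
      define P where "P = (\<lambda>n. \<Prod>k<n. 1 - 1 / (4 * real (\<gamma> k)))"
      have factor: "0 \<le> 1 - 1 / (4 * real (\<gamma> k))" "1 - 1 / (4 * real (\<gamma> k)) \<le> 1" for k
        using assms(1)[of k] by (simp_all add: field_simps)
      have "(\<lambda>n. P (Suc n)) \<longlonglongrightarrow> (\<Prod>l. 1 - 1 / (4 * real (\<gamma> l)))"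
        using convergent_prod_LIMSEQ[OF assms(2)] by (simp only: P_def lessThan_Suc_atMost)
      then have "P \<longlonglongrightarrow> (\<Prod>l. 1 - 1 / (4 * real (\<gamma> l)))" by (rule LIMSEQ_imp_Suc)
      moreover have "decseq P"
      proof (rule decseq_SucI)
        fix n
        have "P n \<ge> 0" unfolding P_def by (intro prod_nonneg) (use factor in auto)
        then have "P n * (1 - 1 / (4 * real (\<gamma> n))) \<le> P n * 1" using factor by (intro mult_left_mono)
        then show "P (Suc n) \<le> P n" by (simp add: P_def)
      qed
      ultimately show "(\<Prod>l. 1 - 1 / (4 * real (\<gamma> l))) \<le> (\<Prod>k<n. 1 - 1 / (4 * real (\<gamma> k)))" for n
        using decseq_ge unfolding P_def by blast
    qed
    ultimately show False using rigid_set_compl_not_null by blast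
  qed
  ultimately show ?thesis by (simp add: T_def T_inv_def)
qed

end
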